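(* Let $\mu\in\mathbb R$, $\sigma^2>0$, let $X_1,X_2,\dots$ be i.i.d. $\mathcal N(\mu,\sigma^2)$, fix $T\in(0,\infty)$, $M\in\mathbb N$ and $\beta>0$, and let $w(t)=\exp(-\beta t^2)$. With $\Delta_m^{(n)}$ and $H_m^{(n)}$ as in the context, for each fixed $m\in\{1,\dots,M\}$, $$\Delta_m^{(n)}=\frac1n\int_{-T}^T w(t)\psi_0(t)^2\big|H_m^{(n)}(t)\big|^2\,dt+o_{\mathbb P}(n^{-1}),$$ hence $\Delta_m^{(n)}=O_{\mathbb P}(n^{-1})$. Moreover, for every $p\ge1$, $\sup_{n\in\mathbb N}\mathbb E\big[(n\Delta_m^{(n)})^p\big]<\infty$; in particular the family $\{(n\Delta_m^{(n)})^p:n\in\mathbb N\}$ is uniformly integrable.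
   Context: For a sample $X_1,\dots,X_n$: $\bar X=\frac1n\sum_k X_k$, $S_X^2=\frac1n\sum_k(X_k-\bar X)^2$, $\widehat\psi_X(t)=\frac1n\sum_k e^{itX_k}$, $\widehat\psi_X^*(t)=\exp(-it\bar X/S_X)\,\widehat\psi_X(t/S_X)$, and $\psi_0(t)=e^{-t^2/2}$. $U_n(t)=\sqrt n(\widehat\psi_X^*(t)-\psi_0(t))$ on $[-T,T]$. For $m\in\mathbb N$: $S_m^{(n)}(t)=(\widehat\psi_X^*(t/\sqrt m))^m$, $D_m^{(n)}=S_{m+1}^{(n)}-S_m^{(n)}$, and the self-similarity discrepancy measure is $\Delta_m^{(n)}=\int_{-T}^T w(t)|D_m^{(n)}(t)|^2\,dt$. Also $$H_m^{(n)}(t)=(m+1)\frac{U_n(t/\sqrt{m+1})}{\psi_0(t/\sqrt{m+1})}-m\frac{U_n(t/\sqrt m)}{\psi_0(t/\sqrt m)}.$$ *)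

theory Defs
  imports "HOL-Probability.Probability"
begin

definition smean :: "(nat \<Rightarrow> 'a \<Rightarrow> real) \<Rightarrow> nat \<Rightarrow> 'a \<Rightarrow> real" where
  "smean X n \<omega> = (\<Sum>k<n. X k \<omega>) / real n"

definition ssd :: "(nat \<Rightarrow> 'a \<Rightarrow> real) \<Rightarrow> nat \<Rightarrow> 'a \<Rightarrow> real" where
  "ssd X n \<omega> = sqrt ((\<Sum>k<n. (X k \<omega> - smean X n \<omega>)\<^sup>2) / real n)"

definition ecf :: "(nat \<Rightarrow> 'a \<Rightarrow> real) \<Rightarrow> nat \<Rightarrow> 'a \<Rightarrow> real \<Rightarrow> complex" where
  "ecf X n \<omega> t = (\<Sum>k<n. cis (t * X k \<omega>)) / of_nat n"

definition ecf_std :: "(nat \<Rightarrow> 'a \<Rightarrow> real) \<Rightarrow> nat \<Rightarrow> 'a \<Rightarrow> real \<Rightarrow> complex" where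
  "ecf_std X n \<omega> t = cis (- t * smean X n \<omega> / ssd X n \<omega>) * ecf X n \<omega> (t / ssd X n \<omega>)"

definition psi0 :: "real \<Rightarrow> real" where
  "psi0 t = exp (- t\<^sup>2 / 2)"

definition Uproc :: "(nat \<Rightarrow> 'a \<Rightarrow> real) \<Rightarrow> nat \<Rightarrow> 'a \<Rightarrow> real \<Rightarrow> complex" where
  "Uproc X n \<omega> t = complex_of_real (sqrt (real n)) * (ecf_std X n \<omega> t - complex_of_real (psi0 t))"

definition Spow :: "(nat \<Rightarrow> 'a \<Rightarrow> real) \<Rightarrow> nat \<Rightarrow> nat \<Rightarrow> 'a \<Rightarrow> real \<Rightarrow> complex" where
  "Spow X m n \<omega> t = (ecf_std X n \<omega> (t / sqrt (real m))) ^ m"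

definition Dfun :: "(nat \<Rightarrow> 'a \<Rightarrow> real) \<Rightarrow> nat \<Rightarrow> nat \<Rightarrow> 'a \<Rightarrow> real \<Rightarrow> complex" where
  "Dfun X m n \<omega> t = Spow X (m + 1) n \<omega> t - Spow X m n \<omega> t"

definition Delta :: "(real \<Rightarrow> real) \<Rightarrow> real \<Rightarrow> (nat \<Rightarrow> 'a \<Rightarrow> real) \<Rightarrow> nat \<Rightarrow> nat \<Rightarrow> 'a \<Rightarrow> real" where
  "Delta w T X m n \<omega> = (\<integral>t\<in>{-T..T}. w t * (cmod (Dfun X m n \<omega> t))\<^sup>2 \<partial>lborel)"

definition Hfun :: "(nat \<Rightarrow> 'a \<Rightarrow> real) \<Rightarrow> nat \<Rightarrow> nat \<Rightarrow> 'a \<Rightarrow> real \<Rightarrow> complex" where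
  "Hfun X m n \<omega> t =
     of_nat (m + 1) * Uproc X n \<omega> (t / sqrt (real (m + 1))) / complex_of_real (psi0 (t / sqrt (real (m + 1))))
     - of_nat m * Uproc X n \<omega> (t / sqrt (real m)) / complex_of_real (psi0 (t / sqrt (real m)))"

definition unif_integrable :: "'a measure \<Rightarrow> ('i \<Rightarrow> 'a \<Rightarrow> real) \<Rightarrow> 'i set \<Rightarrow> bool" where
  "unif_integrable M Y I \<longleftrightarrow>
     (\<forall>i\<in>I. integrable M (Y i)) \<and>
     ((\<lambda>K. SUP i\<in>I. (\<integral>\<^sup>+\<omega>. ennreal (indicator {\<omega>. K < \<bar>Y i \<omega>\<bar>} \<omega> * \<bar>Y i \<omega>\<bar>) \<partial>M)) \<longlongrightarrow> 0) at_top"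

end

theory Submission
  imports Defs
begin

text \<open>
  After standardising to \<open>Z = (X - \<mu>) / \<sigma>\<close>, replacing the studentised empirical characteristic
  function by the plain one costs at most \<open>\<bar>t\<bar> (\<bar>1 - S\<bar> + \<bar>mean\<bar>)\<close>, and \<open>\<bar>1 - S\<bar> \<le> \<bar>1 - S\<^sup>2\<bar>\<close>. Hence
  \<open>\<bar>U\<^sub>n(t)\<bar>\<close> is dominated by normalised sums of the centred variables \<open>cos (t Z) - \<psi>\<^sub>0(t)\<close>, \<open>sin (t Z)\<close>,
  \<open>Z\<^sup>2 - 1\<close> and \<open>Z\<close>. Each of these has an exponential moment, so all moments of the normalised
  sums, and with them those of \<open>U\<^sub>n(t)\<close>, are bounded uniformly in \<open>n\<close> and \<open>\<bar>t\<bar> \<le> T\<close>.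

  Since \<open>\<psi>\<^sub>0(t / \<surd>m)\<^sup>m = \<psi>\<^sub>0(t)\<close>, the estimates \<open>a\<^sup>m - b\<^sup>m = O(a - b)\<close> and
  \<open>a\<^sup>m - b\<^sup>m - m b\<^bsup>m-1\<^esup> (a - b) = O((a - b)\<^sup>2)\<close> on the unit disc bound \<open>n \<bar>D\<bar>\<^sup>2\<close> by a multiple of
  \<open>\<bar>U\<^sub>n\<bar>\<^sup>2\<close> and \<open>n \<bar>D\<bar>\<^sup>2 - \<psi>\<^sub>0\<^sup>2 \<bar>H\<bar>\<^sup>2\<close> by a multiple of \<open>n\<^bsup>-1/2\<^esup> \<bar>U\<^sub>n\<bar>\<^sup>3\<close>. Integrating over \<open>t\<close> and using
  Fubini, Jensen and Markov gives all claims.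
\<close>

section \<open>Moments of normalised sums\<close>

text \<open>Taylor expansion to second order, with the Lagrange remainder bounded crudely. The
  linear term is kept exact because it vanishes in expectation for centred variables.\<close>

lemma exp_le_quadratic_exp_abs:
  fixes y :: real
  shows "exp y \<le> 1 + y + y\<^sup>2 * exp \<bar>y\<bar>"
proof -
  obtain t where t: "\<bar>t\<bar> \<le> \<bar>y\<bar>" "exp y = (\<Sum>k<2. y ^ k / fact k) + exp t / fact 2 * y ^ 2"
    using Maclaurin_exp_le by blast
  have "exp t / 2 \<le> exp \<bar>y\<bar>"
  proof -
    have "exp t \<le> exp \<bar>y\<bar>" using t(1) by simp
    then show ?thesis using exp_ge_zero[of t] by linarith
  qed
  then have "exp t / 2 * y\<^sup>2 \<le> exp \<bar>y\<bar> * y\<^sup>2" by (rule mult_right_mono) simp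
  then show ?thesis using t(2) by (simp add: numeral_2_eq_2 mult.commute)
qed

text \<open>A single term of a nonnegative exponential series is at most its sum. This converts
  exponential moments into power moments.\<close>

lemma power_le_fact_exp:
  fixes x :: real
  assumes "0 \<le> x"
  shows "x ^ N \<le> fact N * exp x"
proof -
  have "(\<Sum>k\<in>{N}. x ^ k /\<^sub>R fact k) \<le> exp x"
    unfolding exp_def
    by (rule sum_le_suminf) (use assms in \<open>auto simp: summable_exp_generic[where 'a=real, simplified]\<close>)
  then show ?thesis by (simp add: field_simps)
qed

context prob_space
begin

text \<open>Chernoff-type argument: by independence the expectation factorises. Centring removes the
  linear Taylor term, so each factor is at most \<open>1 + 2 * B / n\<close>, hence at most
  \<open>exp (2 * B / n)\<close>, and the product of \<open>n\<close> such factors does not depend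
  on \<open>n\<close>.\<close>

lemma exp_normalized_sum_bound:
  fixes Y :: "nat \<Rightarrow> 'a \<Rightarrow> real" and s B :: real
  assumes ind: "indep_vars (\<lambda>_. borel) Y UNIV"
    and int: "\<And>k. integrable M (\<lambda>\<omega>. exp (\<bar>Y k \<omega>\<bar> / 4))"
    and bnd: "\<And>k. expectation (\<lambda>\<omega>. exp (\<bar>Y k \<omega>\<bar> / 4)) \<le> B"
    and mean: "\<And>k. expectation (Y k) = 0"
    and s: "\<bar>s\<bar> = 1 / 8" and n: "n \<ge> 1"
  shows "integrable M (\<lambda>\<omega>. exp (s * ((\<Sum>k<n. Y k \<omega>) / sqrt n)))"
    and "expectation (\<lambda>\<omega>. exp (s * ((\<Sum>k<n. Y k \<omega>) / sqrt n))) \<le> exp (2 * B)"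
proof -
  define r where "r = s / sqrt n"
  have [measurable]: "Y k \<in> borel_measurable M" for k
    using ind by (auto simp: indep_vars_def)
  have rn: "\<bar>r\<bar> \<le> 1 / 8" "r\<^sup>2 = 1 / (64 * n)"
  proof -
    have "\<bar>r\<bar> = (1 / 8) / sqrt n" unfolding r_def abs_divide s by simp
    moreover have "sqrt n \<ge> 1" using n by simp
    ultimately show "\<bar>r\<bar> \<le> 1 / 8" using divide_left_mono[of 1 "sqrt n" "1/8"] by simp
    have "s\<^sup>2 = (1 / 8)\<^sup>2" using s by (metis power2_abs)
    then show "r\<^sup>2 = 1 / (64 * n)" using n unfolding r_def power_divide by (simp add: field_simps)
  qed
  have intY: "integrable M (Y k)" for k
  proof (rule Bochner_Integration.integrable_bound[OF integrable_mult_right[OF int[of k], of 4]])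
    show "AE \<omega> in M. norm (Y k \<omega>) \<le> norm (4 * exp (\<bar>Y k \<omega>\<bar> / 4))"
    proof (intro AE_I2)
      fix \<omega>
      have "1 + \<bar>Y k \<omega>\<bar> / 4 \<le> exp (\<bar>Y k \<omega>\<bar> / 4)" by (rule exp_ge_add_one_self)
      then have "\<bar>Y k \<omega>\<bar> \<le> 4 * exp (\<bar>Y k \<omega>\<bar> / 4)" by linarith
      then show "norm (Y k \<omega>) \<le> norm (4 * exp (\<bar>Y k \<omega>\<bar> / 4))" by (simp add: abs_mult)
    qed
  qed measurable
  have intE: "integrable M (\<lambda>\<omega>. exp (r * Y k \<omega>))" for k
  proof (rule Bochner_Integration.integrable_bound[OF int[of k]])
    show "AE \<omega> in M. norm (exp (r * Y k \<omega>)) \<le> norm (exp (\<bar>Y k \<omega>\<bar> / 4))"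
    proof (intro AE_I2)
      fix \<omega>
      have "r * Y k \<omega> \<le> \<bar>r\<bar> * \<bar>Y k \<omega>\<bar>" by (metis abs_ge_self abs_mult)
      also have "\<dots> \<le> 1 / 8 * \<bar>Y k \<omega>\<bar>" by (rule mult_right_mono) (use rn in auto)
      finally show "norm (exp (r * Y k \<omega>)) \<le> norm (exp (\<bar>Y k \<omega>\<bar> / 4))" by simp
    qed
  qed measurable
  \<comment> \<open>The available exponent \<open>\<bar>Y k \<omega>\<bar> / 4\<close> is spent in
    two halves, which is why \<open>\<bar>s\<bar> = 1 / 8\<close>: one half absorbs the square
    through \<open>?y\<^sup>2 \<le> 2 * exp ?y\<close>, the other dominates the exponential in the
    Taylor remainder. The factor \<open>1 / n\<close> comes from \<open>r\<^sup>2\<close>.\<close>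
  have pw: "exp (r * Y k \<omega>) \<le> 1 + r * Y k \<omega> + 2 / n * exp (\<bar>Y k \<omega>\<bar> / 4)" for k \<omega>
  proof -
    let ?y = "\<bar>Y k \<omega>\<bar> / 8"
    have a: "\<bar>r * Y k \<omega>\<bar> \<le> ?y"
      using mult_right_mono[OF rn(1), of "\<bar>Y k \<omega>\<bar>"] by (simp add: abs_mult)
    have b: "(r * Y k \<omega>)\<^sup>2 = ?y\<^sup>2 / n"
      by (simp add: power_mult_distrib rn power_divide)
    have "(r * Y k \<omega>)\<^sup>2 * exp \<bar>r * Y k \<omega>\<bar> \<le> ?y\<^sup>2 / n * exp ?y"
      unfolding b by (rule mult_left_mono) (use a in auto)
    also have "\<dots> \<le> (2 * exp ?y) / n * exp ?y"
      using power_le_fact_exp[of ?y 2] by (intro mult_right_mono divide_right_mono) auto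
    also have "\<dots> = 2 / n * exp (?y + ?y)" unfolding exp_add by simp
    also have "?y + ?y = \<bar>Y k \<omega>\<bar> / 4" by simp
    finally show ?thesis using exp_le_quadratic_exp_abs[of "r * Y k \<omega>"] by linarith
  qed
  have one: "expectation (\<lambda>\<omega>. exp (r * Y k \<omega>)) \<le> exp (2 * B / n)" for k
  proof -
    have "expectation (\<lambda>\<omega>. exp (r * Y k \<omega>)) \<le>
        expectation (\<lambda>\<omega>. 1 + r * Y k \<omega> + 2 / n * exp (\<bar>Y k \<omega>\<bar> / 4))"
      by (rule integral_mono[OF intE]) (use intY int pw in auto)
    also have "\<dots> = 1 + 2 / n * expectation (\<lambda>\<omega>. exp (\<bar>Y k \<omega>\<bar> / 4))"
      using intY[of k] int[of k] mean[of k] by (simp add: prob_space)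
    also have "\<dots> \<le> 1 + 2 / n * B" using bnd[of k] by (intro add_left_mono mult_left_mono) auto
    also have "\<dots> \<le> exp (2 * B / n)" using exp_ge_add_one_self[of "2 * B / n"] by simp
    finally show ?thesis .
  qed
  have ind': "indep_vars (\<lambda>_. borel) (\<lambda>k \<omega>. exp (r * Y k \<omega>)) {..<n}"
    by (rule indep_vars_compose2[OF indep_vars_subset[OF ind]]) auto
  have eq: "exp (s * ((\<Sum>k<n. Y k \<omega>) / sqrt n)) = (\<Prod>k<n. exp (r * Y k \<omega>))" for \<omega>
    by (simp add: r_def exp_sum[symmetric] sum_distrib_left sum_divide_distrib)
  show "integrable M (\<lambda>\<omega>. exp (s * ((\<Sum>k<n. Y k \<omega>) / sqrt n)))"
    unfolding eq by (rule indep_vars_integrable[OF _ ind']) (use intE in auto)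
  have "expectation (\<lambda>\<omega>. exp (s * ((\<Sum>k<n. Y k \<omega>) / sqrt n))) =
      (\<Prod>k<n. expectation (\<lambda>\<omega>. exp (r * Y k \<omega>)))"
    unfolding eq by (rule indep_vars_lebesgue_integral[OF _ ind']) (use intE in auto)
  also have "\<dots> \<le> (\<Prod>k<n. exp (2 * B / n))"
    by (rule prod_mono) (use one in auto)
  also have "\<dots> = exp (2 * B)" using n by (simp add: exp_of_nat_mult[symmetric])
  finally show "expectation (\<lambda>\<omega>. exp (s * ((\<Sum>k<n. Y k \<omega>) / sqrt n))) \<le> exp (2 * B)" .
qed

text \<open>A power of \<open>\<bar>x\<bar> / 8\<close> is controlled by
  \<open>exp (\<bar>x\<bar> / 8)\<close>, and this by the sum of the exponentials for the two signs
  of \<open>s\<close>; hence the factor 2. The bound is uniform in \<open>n\<close>.\<close>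

lemma normalized_sum_moment_bound:
  fixes Y :: "nat \<Rightarrow> 'a \<Rightarrow> real" and B :: real
  assumes ind: "indep_vars (\<lambda>_. borel) Y UNIV"
    and int: "\<And>k. integrable M (\<lambda>\<omega>. exp (\<bar>Y k \<omega>\<bar> / 4))"
    and bnd: "\<And>k. expectation (\<lambda>\<omega>. exp (\<bar>Y k \<omega>\<bar> / 4)) \<le> B"
    and mean: "\<And>k. expectation (Y k) = 0"
    and n: "n \<ge> 1"
  shows "(\<integral>\<^sup>+\<omega>. ennreal (\<bar>(\<Sum>k<n. Y k \<omega>) / sqrt n\<bar> ^ N) \<partial>M)
    \<le> ennreal (8 ^ N * fact N * 2 * exp (2 * B))"
proof -
  let ?S = "\<lambda>\<omega>. (\<Sum>k<n. Y k \<omega>) / sqrt n"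
  let ?g = "\<lambda>\<omega>. 8 ^ N * fact N * (exp (1 / 8 * ?S \<omega>) + exp (- (1 / 8) * ?S \<omega>))"
  note p = exp_normalized_sum_bound[OF ind int bnd mean _ n, of "1/8"]
  note q = exp_normalized_sum_bound[OF ind int bnd mean _ n, of "-(1/8)"]
  have "\<bar>x\<bar> ^ N \<le> 8 ^ N * fact N * (exp (1 / 8 * x) + exp (- (1 / 8) * x))" for x :: real
  proof -
    have "(\<bar>x\<bar> / 8) ^ N \<le> fact N * exp (\<bar>x\<bar> / 8)"
      by (rule power_le_fact_exp) simp
    also have "\<dots> \<le> fact N * (exp (1 / 8 * x) + exp (- (1 / 8) * x))"
      by (cases "x \<ge> 0") auto
    finally show ?thesis by (simp add: power_divide field_simps)
  qed
  then have pw: "\<bar>?S \<omega>\<bar> ^ N \<le> ?g \<omega>" for \<omega> .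
  have "(\<integral>\<^sup>+\<omega>. ennreal (\<bar>?S \<omega>\<bar> ^ N) \<partial>M) \<le> (\<integral>\<^sup>+\<omega>. ennreal (?g \<omega>) \<partial>M)"
    by (intro nn_integral_mono ennreal_leI pw)
  also have "\<dots> = ennreal (expectation ?g)"
    by (rule nn_integral_eq_integral) (use p(1) q(1) in \<open>auto intro!: AE_I2 add_nonneg_nonneg\<close>)
  also have "expectation ?g = 8 ^ N * fact N *
      (expectation (\<lambda>\<omega>. exp (1 / 8 * ?S \<omega>)) + expectation (\<lambda>\<omega>. exp (- (1 / 8) * ?S \<omega>)))"
    using p(1) q(1) by simp
  also have "ennreal \<dots> \<le> ennreal (8 ^ N * fact N * (exp (2 * B) + exp (2 * B)))"
    using p(2) q(2) by (intro ennreal_leI mult_left_mono add_mono) auto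
  finally show ?thesis by (simp add: ac_simps)
qed

end

section \<open>The studentised empirical characteristic function\<close>

text \<open>A rotation by \<open>cis b\<close> reduces the claim to the first-order estimate of
  \<open>cis x - 1\<close>.\<close>

lemma norm_cis_diff_le: "cmod (cis a - cis b) \<le> \<bar>a - b\<bar>"
proof -
  have "cis a - cis b = cis b * (cis (a - b) - 1)"
    by (simp add: algebra_simps cis_mult)
  moreover have "cmod (cis (a - b) - 1) \<le> \<bar>a - b\<bar>"
    using iexp_approx1[of "a - b" 0] by (simp add: cis_conv_exp)
  ultimately show ?thesis by (simp add: norm_mult)
qed

text \<open>The phase \<open>cis (- t * smean X n \<omega> / ssd X n \<omega>)\<close> is absorbed
  into every summand. The identity survives \<open>ssd X n \<omega> = 0\<close>: division by zero
  yields 0, so all summands are 1.\<close>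

lemma ecf_std_eq_average:
  "ecf_std X n \<omega> t = (\<Sum>k<n. cis (t * ((X k \<omega> - smean X n \<omega>) / ssd X n \<omega>))) / of_nat n"
  unfolding ecf_std_def ecf_def
  by (simp add: sum_distrib_left cis_mult algebra_simps diff_divide_distrib)

text \<open>An average of unimodular numbers lies in the unit disc, where taking powers is
  Lipschitz.\<close>

lemma norm_ecf_std_le_1: "cmod (ecf_std X n \<omega> t) \<le> 1"
proof -
  have "cmod (\<Sum>k<n. cis (t * ((X k \<omega> - smean X n \<omega>) / ssd X n \<omega>))) \<le> (\<Sum>k<n. 1)"
    by (rule sum_norm_le) simp
  then show ?thesis unfolding ecf_std_eq_average by (simp add: norm_divide divide_le_eq)
qed

text \<open>Residuals and standard deviation scale by the same factor \<open>1 / c\<close>. This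
  reduces an arbitrary normal sample to a standard one.\<close>

lemma ecf_std_affine_invariant:
  assumes "c > 0" "n \<ge> 1"
  shows "ecf_std (\<lambda>k \<omega>. (X k \<omega> - a) / c) n \<omega> t = ecf_std X n \<omega> t"
proof -
  let ?Z = "\<lambda>k \<omega>. (X k \<omega> - a) / c"
  have m: "smean ?Z n \<omega> = (smean X n \<omega> - a) / c"
    using assms by (simp add: smean_def sum_divide_distrib[symmetric] sum_subtractf field_simps)
  have d: "?Z k \<omega> - smean ?Z n \<omega> = (X k \<omega> - smean X n \<omega>) / c" for k
    unfolding m by (simp add: diff_divide_distrib)
  have "ssd ?Z n \<omega> = ssd X n \<omega> / c"
    unfolding ssd_def d
    using assms by (simp add: power_divide sum_divide_distrib[symmetric] real_sqrt_divide real_sqrt_mult)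
  then show ?thesis unfolding ecf_std_eq_average d using assms by simp
qed

text \<open>The variance decomposition expresses \<open>1 - S\<^sup>2\<close> through averages of
  \<open>Z\<^sup>2 - 1\<close> and \<open>Z\<close>, to which the moment bounds for sums
  apply.\<close>

lemma ssd_sq:
  assumes "n \<ge> 1"
  shows "(ssd X n \<omega>)\<^sup>2 = (\<Sum>k<n. (X k \<omega>)\<^sup>2) / n - (smean X n \<omega>)\<^sup>2"
proof -
  have s: "(\<Sum>k<n. X k \<omega>) = n * smean X n \<omega>" using assms by (simp add: smean_def)
  have "(\<Sum>k<n. (X k \<omega> - smean X n \<omega>)\<^sup>2) =
      (\<Sum>k<n. (X k \<omega>)\<^sup>2) + n * (smean X n \<omega>)\<^sup>2 - 2 * smean X n \<omega> * (\<Sum>k<n. X k \<omega>)"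
    by (simp add: power2_diff sum.distrib sum_subtractf sum_distrib_left algebra_simps)
  also have "\<dots> = (\<Sum>k<n. (X k \<omega>)\<^sup>2) - n * (smean X n \<omega>)\<^sup>2"
    unfolding s by (simp add: power2_eq_square)
  finally have "(\<Sum>k<n. (X k \<omega> - smean X n \<omega>)\<^sup>2) / n = (\<Sum>k<n. (X k \<omega>)\<^sup>2) / n - (smean X n \<omega>)\<^sup>2"
    using assms by (simp add: diff_divide_distrib)
  moreover have "0 \<le> (\<Sum>k<n. (X k \<omega> - smean X n \<omega>)\<^sup>2) / n" by (simp add: sum_nonneg)
  ultimately show ?thesis unfolding ssd_def by (metis real_sqrt_pow2)
qed

text \<open>Cauchy--Schwarz bounds the mean absolute deviation by the standard deviation, which
  cancels the factor \<open>1 / S\<close>: no lower bound on \<open>S\<close> is ever needed.\<close>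

lemma norm_ecf_std_minus_ecf_le:
  assumes n: "n \<ge> 1"
  shows "cmod (ecf_std X n \<omega> t - ecf X n \<omega> t) \<le> \<bar>t\<bar> * (\<bar>1 - ssd X n \<omega>\<bar> + \<bar>smean X n \<omega>\<bar>)"
proof -
  define a where "a = smean X n \<omega>"
  define s where "s = ssd X n \<omega>"
  have s0: "s \<ge> 0" unfolding s_def ssd_def by (simp add: sum_nonneg)
  have s2: "n * s\<^sup>2 = (\<Sum>k<n. (X k \<omega> - a)\<^sup>2)"
    unfolding s_def ssd_def a_def using n by (simp add: sum_nonneg)
  have mad: "(\<Sum>k<n. \<bar>X k \<omega> - a\<bar>) \<le> n * s"
  proof (rule power2_le_imp_le)
    have "(\<Sum>k<n. \<bar>X k \<omega> - a\<bar>)\<^sup>2 \<le> (\<Sum>k<n. \<bar>X k \<omega> - a\<bar>\<^sup>2) * n"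
      using sum_squared_le_sum_of_squares[of "\<lambda>k. \<bar>X k \<omega> - a\<bar>" "{..<n}"] by simp
    also have "\<dots> = (n * s)\<^sup>2"
      using s2 by (simp add: power2_eq_square algebra_simps)
    finally show "(\<Sum>k<n. \<bar>X k \<omega> - a\<bar>)\<^sup>2 \<le> (n * s)\<^sup>2" .
  qed (use s0 in simp)
  \<comment> \<open>The phase error splits into a scale error, proportional to the residual, and a
    shift error \<open>a\<close>.\<close>
  have term_le: "\<bar>t * ((X k \<omega> - a) / s) - t * X k \<omega>\<bar> \<le> \<bar>t\<bar> * (\<bar>X k \<omega> - a\<bar> * \<bar>1 / s - 1\<bar> + \<bar>a\<bar>)" for k
  proof -
    have "t * ((X k \<omega> - a) / s) - t * X k \<omega> = t * ((X k \<omega> - a) * (1 / s - 1) - a)"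
      by (simp add: algebra_simps diff_divide_distrib)
    then have "\<bar>t * ((X k \<omega> - a) / s) - t * X k \<omega>\<bar> = \<bar>t\<bar> * \<bar>(X k \<omega> - a) * (1 / s - 1) - a\<bar>"
      by (simp add: abs_mult)
    also have "\<dots> \<le> \<bar>t\<bar> * (\<bar>X k \<omega> - a\<bar> * \<bar>1 / s - 1\<bar> + \<bar>a\<bar>)"
      using abs_triangle_ineq4[of "(X k \<omega> - a) * (1 / s - 1)" a]
      by (intro mult_left_mono) (auto simp: abs_mult)
    finally show ?thesis .
  qed
  \<comment> \<open>The factor \<open>s\<close> makes the left-hand side 0 for a degenerate sample,
    and otherwise cancels the denominator exactly.\<close>
  have ss: "s * \<bar>1 / s - 1\<bar> \<le> \<bar>1 - s\<bar>"
  proof (cases "s = 0")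
    case False
    then have "s * \<bar>1 / s - 1\<bar> = \<bar>s * (1 / s - 1)\<bar>" using s0 by (simp add: abs_mult)
    then show ?thesis using False by (simp add: right_diff_distrib)
  qed simp
  have "cmod (ecf_std X n \<omega> t - ecf X n \<omega> t) =
      cmod (\<Sum>k<n. cis (t * ((X k \<omega> - a) / s)) - cis (t * X k \<omega>)) / n"
    unfolding ecf_std_eq_average ecf_def a_def s_def
    by (simp add: sum_subtractf diff_divide_distrib[symmetric] norm_divide)
  also have "\<dots> \<le> (\<Sum>k<n. \<bar>t\<bar> * (\<bar>X k \<omega> - a\<bar> * \<bar>1 / s - 1\<bar> + \<bar>a\<bar>)) / n"
    by (intro divide_right_mono sum_norm_le order_trans[OF norm_cis_diff_le term_le]) simp
  also have "\<dots> = \<bar>t\<bar> * ((\<Sum>k<n. \<bar>X k \<omega> - a\<bar>) / n * \<bar>1 / s - 1\<bar> + \<bar>a\<bar>)"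
    using n by (simp add: sum.distrib sum_distrib_left[symmetric] sum_distrib_right[symmetric] field_simps)
  also have "\<dots> \<le> \<bar>t\<bar> * (s * \<bar>1 / s - 1\<bar> + \<bar>a\<bar>)"
    using mad n by (intro mult_left_mono add_right_mono mult_right_mono) (auto simp: divide_le_eq mult.commute)
  also have "\<dots> \<le> \<bar>t\<bar> * (\<bar>1 - s\<bar> + \<bar>a\<bar>)"
    using ss by (intro mult_left_mono) auto
  finally show ?thesis unfolding s_def a_def .
qed

text \<open>Split at the plain \<open>ecf\<close>: the first two terms are the real and imaginary
  parts of the scaled error \<open>ecf - psi0\<close>, the remaining three are the cost of
  estimating scale and location. All are built from normalised sums of centred variables.\<close>

lemma norm_Uproc_le:
  fixes Z :: "nat \<Rightarrow> 'a \<Rightarrow> real" and \<omega> :: 'a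
  assumes n: "n \<ge> 1" and t: "\<bar>t\<bar> \<le> T"
  defines "G \<equiv> (\<Sum>k<n. Z k \<omega>) / sqrt n"
  shows "cmod (Uproc Z n \<omega> t) \<le>
    \<bar>(\<Sum>k<n. cos (t * Z k \<omega>) - psi0 t) / sqrt n\<bar> + \<bar>(\<Sum>k<n. sin (t * Z k \<omega>)) / sqrt n\<bar>
    + T * \<bar>(\<Sum>k<n. (Z k \<omega>)\<^sup>2 - 1) / sqrt n\<bar> + T * \<bar>G\<bar> ^ 2 + T * \<bar>G\<bar>"
proof -
  let ?a = "smean Z n \<omega>" and ?s = "ssd Z n \<omega>" and ?r = "sqrt (real n)"
  let ?B = "(\<Sum>k<n. (Z k \<omega>)\<^sup>2 - 1) / ?r"
  have r: "?r \<ge> 1" "?r > 0" "?r * ?r = n" using n by auto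
  have div_r: "x / ?r = ?r * (x / n)" for x
    using r by (metis nonzero_mult_divide_mult_cancel_left less_irrefl times_divide_eq_right)
  have G: "G = ?r * ?a" unfolding G_def smean_def by (rule div_r)
  have s0: "?s \<ge> 0" unfolding ssd_def by (simp add: sum_nonneg)
  \<comment> \<open>Since \<open>?s \<ge> 0\<close>, the factor \<open>1 + ?s\<close> is at least 1.
    It trades the square root \<open>?s\<close> for \<open>?s\<^sup>2\<close>, a polynomial in the
    sample.\<close>
  have "\<bar>1 - ?s\<bar> \<le> \<bar>1 - ?s\<bar> * (1 + ?s)" using s0 by (simp add: mult_le_cancel_left1)
  also have "\<dots> = \<bar>1 - ?s\<^sup>2\<bar>"
  proof -
    have "\<bar>1 - ?s\<^sup>2\<bar> = \<bar>(1 - ?s) * (1 + ?s)\<bar>" by (simp add: power2_eq_square algebra_simps)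
    then show ?thesis using s0 by (simp add: abs_mult)
  qed
  finally have "?r * \<bar>1 - ?s\<bar> \<le> ?r * \<bar>1 - ?s\<^sup>2\<bar>" using r by simp
  also have "\<dots> = \<bar>?B - ?r * ?a\<^sup>2\<bar>"
  proof -
    have "?B - ?r * ?a\<^sup>2 = - (?r * (1 - ?s\<^sup>2))"
      unfolding div_r ssd_sq[OF n] using n by (simp add: sum_subtractf diff_divide_distrib algebra_simps)
    then show ?thesis using r by (simp add: abs_mult)
  qed
  also have "\<dots> \<le> \<bar>?B\<bar> + ?r * ?a\<^sup>2"
    using abs_triangle_ineq4[of ?B "?r * ?a\<^sup>2"] r by simp
  \<comment> \<open>Here \<open>?r * ?a\<^sup>2\<close> equals
    \<open>\<bar>G\<bar>\<^sup>2 / ?r\<close>; the decay \<open>1 / ?r\<close> is given away because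
    boundedness suffices.\<close>
  also have "?r * ?a\<^sup>2 \<le> \<bar>G\<bar> ^ 2"
    unfolding G using mult_right_mono[of 1 ?r "?r * ?a\<^sup>2"] r by (simp add: power2_eq_square algebra_simps)
  finally have dev: "?r * \<bar>1 - ?s\<bar> \<le> \<bar>?B\<bar> + \<bar>G\<bar> ^ 2" by simp
  have ga: "?r * \<bar>?a\<bar> = \<bar>G\<bar>" unfolding G using r by (simp add: abs_mult)
  have "cmod (?r * (ecf_std Z n \<omega> t - ecf Z n \<omega> t)) \<le> ?r * (\<bar>t\<bar> * (\<bar>1 - ?s\<bar> + \<bar>?a\<bar>))"
    using norm_ecf_std_minus_ecf_le[OF n, of Z \<omega> t] r by (simp add: norm_mult)
  also have "\<dots> = \<bar>t\<bar> * (?r * \<bar>1 - ?s\<bar> + ?r * \<bar>?a\<bar>)" by (simp add: algebra_simps)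
  also have "\<dots> \<le> T * (?r * \<bar>1 - ?s\<bar> + ?r * \<bar>?a\<bar>)" using t r by (intro mult_right_mono) auto
  also have "\<dots> \<le> T * ((\<bar>?B\<bar> + \<bar>G\<bar> ^ 2) + \<bar>G\<bar>)"
    using dev t unfolding ga by (intro mult_left_mono add_right_mono) auto
  finally have 1: "cmod (?r * (ecf_std Z n \<omega> t - ecf Z n \<omega> t)) \<le> T * ((\<bar>?B\<bar> + \<bar>G\<bar> ^ 2) + \<bar>G\<bar>)" .
  let ?E = "?r * (ecf Z n \<omega> t - psi0 t)"
  have "Re ?E = (\<Sum>k<n. cos (t * Z k \<omega>) - psi0 t) / ?r"
    unfolding div_r ecf_def using n by (simp add: sum_subtractf diff_divide_distrib)
  moreover have "Im ?E = (\<Sum>k<n. sin (t * Z k \<omega>)) / ?r"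
    unfolding div_r ecf_def by simp
  ultimately have 2: "cmod ?E \<le> \<bar>(\<Sum>k<n. cos (t * Z k \<omega>) - psi0 t) / ?r\<bar> + \<bar>(\<Sum>k<n. sin (t * Z k \<omega>)) / ?r\<bar>"
    using cmod_le[of ?E] by simp
  have "Uproc Z n \<omega> t = ?r * (ecf_std Z n \<omega> t - ecf Z n \<omega> t) + ?E"
    unfolding Uproc_def by (simp add: algebra_simps)
  then have "cmod (Uproc Z n \<omega> t) \<le> cmod (?r * (ecf_std Z n \<omega> t - ecf Z n \<omega> t)) + cmod ?E"
    by (metis norm_triangle_ineq)
  then show ?thesis using 1 2 by (simp add: algebra_simps)
qed

section \<open>Moments of the empirical process\<close>

lemma power_add_le:
  fixes a b :: real
  assumes "0 \<le> a" "0 \<le> b"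
  shows "(a + b) ^ N \<le> 2 ^ N * (a ^ N + b ^ N)"
proof -
  have "(a + b) ^ N \<le> (2 * max a b) ^ N" using assms by (intro power_mono) auto
  also have "\<dots> \<le> 2 ^ N * (a ^ N + b ^ N)"
    unfolding power_mult_distrib using assms by (intro mult_left_mono) (auto simp: max_def)
  finally show ?thesis .
qed

text \<open>A crude replacement for Minkowski's inequality. Extended integrals with explicit finite
  bounds let it be iterated along a sum without integrability obligations.\<close>

lemma nn_integral_power_add_le:
  fixes f g :: "'a \<Rightarrow> real"
  assumes [measurable]: "f \<in> borel_measurable M" "g \<in> borel_measurable M"
    and "0 \<le> A" "0 \<le> B"
    and f: "(\<integral>\<^sup>+x. ennreal (\<bar>f x\<bar> ^ N) \<partial>M) \<le> ennreal A"
    and g: "(\<integral>\<^sup>+x. ennreal (\<bar>g x\<bar> ^ N) \<partial>M) \<le> ennreal B"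
  shows "(\<integral>\<^sup>+x. ennreal (\<bar>f x + g x\<bar> ^ N) \<partial>M) \<le> ennreal (2 ^ N * (A + B))"
proof -
  have "(\<integral>\<^sup>+x. ennreal (\<bar>f x + g x\<bar> ^ N) \<partial>M) \<le>
      (\<integral>\<^sup>+x. ennreal (2 ^ N) * (ennreal (\<bar>f x\<bar> ^ N) + ennreal (\<bar>g x\<bar> ^ N)) \<partial>M)"
  proof (rule nn_integral_mono)
    fix x
    have "\<bar>f x + g x\<bar> ^ N \<le> (\<bar>f x\<bar> + \<bar>g x\<bar>) ^ N" by (intro power_mono) auto
    also have "\<dots> \<le> 2 ^ N * (\<bar>f x\<bar> ^ N + \<bar>g x\<bar> ^ N)" by (rule power_add_le) auto
    finally show "ennreal (\<bar>f x + g x\<bar> ^ N) \<le> ennreal (2 ^ N) * (ennreal (\<bar>f x\<bar> ^ N) + ennreal (\<bar>g x\<bar> ^ N))"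
      by (subst ennreal_plus[symmetric], simp, simp, subst ennreal_mult[symmetric]) (auto intro: ennreal_leI)
  qed
  also have "\<dots> = ennreal (2 ^ N) * ((\<integral>\<^sup>+x. ennreal (\<bar>f x\<bar> ^ N) \<partial>M) + (\<integral>\<^sup>+x. ennreal (\<bar>g x\<bar> ^ N) \<partial>M))"
    by (subst nn_integral_cmult, simp, subst nn_integral_add) auto
  also have "\<dots> \<le> ennreal (2 ^ N) * (ennreal A + ennreal B)"
    using f g by (intro mult_left_mono add_mono) auto
  also have "\<dots> = ennreal (2 ^ N * (A + B))"
    using assms by (subst ennreal_plus[symmetric], simp, simp, subst ennreal_mult[symmetric]) auto
  finally show ?thesis .
qed

lemma nn_integral_cmult_le:
  fixes f :: "'a \<Rightarrow> real"
  assumes "f \<in> borel_measurable M" "0 \<le> c" "0 \<le> C" "(\<integral>\<^sup>+x. ennreal (f x) \<partial>M) \<le> ennreal C"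
  shows "(\<integral>\<^sup>+x. ennreal (c * f x) \<partial>M) \<le> ennreal (c * C)"
  using assms by (simp add: ennreal_mult' nn_integral_cmult mult_left_mono)

lemma nn_integral_power_cmult_le:
  fixes f :: "'a \<Rightarrow> real"
  assumes [measurable]: "f \<in> borel_measurable M"
    and "0 \<le> c" "0 \<le> A"
    and "(\<integral>\<^sup>+x. ennreal (\<bar>f x\<bar> ^ N) \<partial>M) \<le> ennreal A"
  shows "(\<integral>\<^sup>+x. ennreal (\<bar>c * f x\<bar> ^ N) \<partial>M) \<le> ennreal (c ^ N * A)"
  using nn_integral_cmult_le[of "\<lambda>x. \<bar>f x\<bar> ^ N" M "c ^ N" A] assms
  by (simp add: abs_mult power_mult_distrib)

lemma psi0_pos: "0 < psi0 t" and psi0_le_1: "psi0 t \<le> 1"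
  by (auto simp: psi0_def)

section \<open>Gaussian expectations and uniform moments of \<open>Uproc\<close>\<close>

context prob_space
begin

text \<open>The factor \<open>exp (x\<^sup>2 / 4)\<close> only widens the Gaussian: the product is a
  multiple of the normal density with standard deviation \<open>sqrt 2\<close>. The exponent
  \<open>x\<^sup>2 + 1\<close> is chosen to dominate both \<open>\<bar>x\<^sup>2 - 1\<bar>\<close>
  and \<open>\<bar>x\<bar>\<close>.\<close>

lemma std_normal_exp_square:
  assumes Z: "distributed M lborel Z std_normal_density"
  shows "integrable M (\<lambda>\<omega>. exp (((Z \<omega>)\<^sup>2 + 1) / 4))"
    and "expectation (\<lambda>\<omega>. exp (((Z \<omega>)\<^sup>2 + 1) / 4)) = sqrt 2 * exp (1 / 4)"
proof -
  have eq: "std_normal_density x * exp ((x\<^sup>2 + 1) / 4) = sqrt 2 * exp (1 / 4) * normal_density 0 (sqrt 2) x" for x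
  proof -
    have "exp (- x\<^sup>2 / 2) * exp ((x\<^sup>2 + 1) / 4) = exp (1 / 4) * exp (- x\<^sup>2 / 4)"
      by (simp add: exp_add[symmetric] field_simps)
    then show ?thesis
      by (simp add: normal_density_def real_sqrt_mult field_simps)
  qed
  show "integrable M (\<lambda>\<omega>. exp (((Z \<omega>)\<^sup>2 + 1) / 4))"
    by (subst distributed_integrable[OF Z, symmetric]) (auto simp: eq)
  show "expectation (\<lambda>\<omega>. exp (((Z \<omega>)\<^sup>2 + 1) / 4)) = sqrt 2 * exp (1 / 4)"
    by (subst distributed_integral[OF Z, symmetric]) (auto simp: eq)
qed

lemma std_normal_second_moment:
  assumes Z: "distributed M lborel Z std_normal_density"
  shows "integrable M (\<lambda>\<omega>. (Z \<omega>)\<^sup>2)" and "expectation (\<lambda>\<omega>. (Z \<omega>)\<^sup>2) = 1"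
proof -
  show "integrable M (\<lambda>\<omega>. (Z \<omega>)\<^sup>2)"
    using std_normal_moment_even[of 1]
    by (subst distributed_integrable[OF Z, symmetric]) (auto simp: has_bochner_integral_iff)
  show "expectation (\<lambda>\<omega>. (Z \<omega>)\<^sup>2) = 1"
    using integral_std_normal_moment_even[of 1]
    by (subst distributed_integral[OF Z, symmetric]) auto
qed

text \<open>Real and imaginary part of the standard normal characteristic function, which is
  real.\<close>

lemma std_normal_cos_sin:
  assumes Z: "distributed M lborel Z std_normal_density"
  shows "expectation (\<lambda>\<omega>. cos (t * Z \<omega>)) = psi0 t" and "expectation (\<lambda>\<omega>. sin (t * Z \<omega>)) = 0"
proof -
  have [measurable]: "Z \<in> borel_measurable M"
    using distributed_measurable[OF Z] by simp
  have "char (distr M lborel Z) t = psi0 t"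
    using distributed_distr_eq_density[OF Z] char_std_normal_distribution
    by (simp add: psi0_def fun_eq_iff)
  then have *: "expectation (\<lambda>\<omega>. iexp (t * Z \<omega>)) = psi0 t"
    unfolding char_def by (subst (asm) integral_distr) auto
  have int: "integrable M (\<lambda>\<omega>. iexp (t * Z \<omega>))"
    by (rule integrable_const_bound[of _ 1]) auto
  show "expectation (\<lambda>\<omega>. cos (t * Z \<omega>)) = psi0 t"
    using arg_cong[OF *, of Re] integral_Re[OF int] by (simp add: Re_exp)
  show "expectation (\<lambda>\<omega>. sin (t * Z \<omega>)) = 0"
    using arg_cong[OF *, of Im] integral_Im[OF int] by (simp add: Im_exp)
qed

text \<open>Serves the trigonometric summands. The constant depends only on the bound 2, hence is
  the same for every argument \<open>t\<close>.\<close>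

lemma normalized_sum_moment_bound_bounded:
  fixes Y :: "nat \<Rightarrow> 'a \<Rightarrow> real"
  assumes ind: "indep_vars (\<lambda>_. borel) Y UNIV"
    and bnd: "\<And>k \<omega>. \<bar>Y k \<omega>\<bar> \<le> 2"
    and mean: "\<And>k. expectation (Y k) = 0"
    and n: "n \<ge> 1"
  shows "(\<integral>\<^sup>+\<omega>. ennreal (\<bar>(\<Sum>k<n. Y k \<omega>) / sqrt n\<bar> ^ N) \<partial>M)
    \<le> ennreal (8 ^ N * fact N * 2 * exp (2 * exp (1 / 2)))"
proof (rule normalized_sum_moment_bound[OF ind _ _ mean n])
  fix k
  have [measurable]: "Y k \<in> borel_measurable M"
    using ind by (auto simp: indep_vars_def)
  have le: "exp (\<bar>Y k \<omega>\<bar> / 4) \<le> exp (1 / 2)" for \<omega> using bnd[of k \<omega>] by simp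
  show int: "integrable M (\<lambda>\<omega>. exp (\<bar>Y k \<omega>\<bar> / 4))"
    by (rule integrable_const_bound[of _ "exp (1 / 2)"]) (use le in auto)
  show "expectation (\<lambda>\<omega>. exp (\<bar>Y k \<omega>\<bar> / 4)) \<le> exp (1 / 2)"
    by (rule integral_le_const[OF int]) (use le in auto)
qed

text \<open>Serves the unbounded summands \<open>Z\<^sup>2 - 1\<close> and \<open>Z\<close>; their
  exponential moment is dominated by the one in \<open>std_normal_exp_square\<close>.\<close>

lemma normalized_sum_moment_bound_normal:
  fixes Z :: "nat \<Rightarrow> 'a \<Rightarrow> real" and h :: "real \<Rightarrow> real"
  assumes ind: "indep_vars (\<lambda>_. borel) Z UNIV"
    and Z: "\<And>k. distributed M lborel (Z k) std_normal_density"
    and h[measurable]: "h \<in> borel_measurable borel"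
    and bnd: "\<And>x. \<bar>h x\<bar> \<le> x\<^sup>2 + 1"
    and mean: "\<And>k. expectation (\<lambda>\<omega>. h (Z k \<omega>)) = 0"
    and n: "n \<ge> 1"
  shows "(\<integral>\<^sup>+\<omega>. ennreal (\<bar>(\<Sum>k<n. h (Z k \<omega>)) / sqrt n\<bar> ^ N) \<partial>M)
    \<le> ennreal (8 ^ N * fact N * 2 * exp (2 * (sqrt 2 * exp (1 / 4))))"
proof (rule normalized_sum_moment_bound[OF _ _ _ mean n])
  show "indep_vars (\<lambda>_. borel) (\<lambda>k \<omega>. h (Z k \<omega>)) UNIV"
    by (rule indep_vars_compose2[OF ind]) auto
  fix k
  have [measurable]: "Z k \<in> borel_measurable M"
    using ind by (auto simp: indep_vars_def)
  have le: "exp (\<bar>h (Z k \<omega>)\<bar> / 4) \<le> exp (((Z k \<omega>)\<^sup>2 + 1) / 4)" for \<omega>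
    using bnd[of "Z k \<omega>"] by simp
  note E = std_normal_exp_square[OF Z[of k]]
  show int: "integrable M (\<lambda>\<omega>. exp (\<bar>h (Z k \<omega>)\<bar> / 4))"
    by (rule Bochner_Integration.integrable_bound[OF E(1)]) (use le in auto)
  show "expectation (\<lambda>\<omega>. exp (\<bar>h (Z k \<omega>)\<bar> / 4)) \<le> sqrt 2 * exp (1 / 4)"
    unfolding E(2)[symmetric] by (rule integral_mono[OF int E(1) le])
qed

text \<open>Each of the five terms of \<open>norm_Uproc_le\<close> has an \<open>N\<close>-th moment
  bounded independently of \<open>n\<close> and \<open>t\<close>.\<close>

lemma Uproc_moment_bound_std:
  fixes Z :: "nat \<Rightarrow> 'a \<Rightarrow> real"
  assumes ind: "indep_vars (\<lambda>_. borel) Z UNIV"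
    and Z: "\<And>k. distributed M lborel (Z k) std_normal_density"
    and T: "T \<ge> 0"
  shows "\<exists>C\<ge>0. \<forall>n\<ge>1. \<forall>t. \<bar>t\<bar> \<le> T \<longrightarrow>
    (\<integral>\<^sup>+\<omega>. ennreal (cmod (Uproc Z n \<omega> t) ^ N) \<partial>M) \<le> ennreal C"
proof -
  have [measurable]: "Z k \<in> borel_measurable M" for k
    using ind by (auto simp: indep_vars_def)
  define b :: real where "b = exp (2 * exp (1 / 2))"
  define c :: real where "c = exp (2 * (sqrt 2 * exp (1 / 4)))"
  define K where "K j = (8 ^ j * fact j * 2 :: real)" for j :: nat
  have K0: "K j \<ge> 0" "b \<ge> 0" "c \<ge> 0" for j unfolding K_def b_def c_def by auto
  let ?A = "\<lambda>n t \<omega>. \<bar>(\<Sum>k<n. cos (t * Z k \<omega>) - psi0 t) / sqrt (real n)\<bar>"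
  let ?A' = "\<lambda>n t \<omega>. \<bar>(\<Sum>k<n. sin (t * Z k \<omega>)) / sqrt (real n)\<bar>"
  let ?B = "\<lambda>n \<omega>. \<bar>(\<Sum>k<n. (Z k \<omega>)\<^sup>2 - 1) / sqrt (real n)\<bar>"
  let ?G = "\<lambda>n \<omega>. \<bar>(\<Sum>k<n. Z k \<omega>) / sqrt (real n)\<bar>"
  \<comment> \<open>The nesting mirrors the left-associated sum of five terms, one factor
    \<open>2 ^ N\<close> per addition. The entry \<open>K (2 * N)\<close> appears because the
    \<open>N\<close>-th moment of \<open>G\<^sup>2\<close> is the moment of \<open>G\<close> of
    order \<open>2 * N\<close>.\<close>
  define C where "C = 2 ^ N * (2 ^ N * (2 ^ N * (2 ^ N * (K N * b + K N * b) + T ^ N * (K N * c))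
      + T ^ N * (K (2 * N) * c)) + T ^ N * (K N * c))"
  have C0: "C \<ge> 0" unfolding C_def using K0 T by (intro mult_nonneg_nonneg add_nonneg_nonneg) auto
  have main: "(\<integral>\<^sup>+\<omega>. ennreal (cmod (Uproc Z n \<omega> t) ^ N) \<partial>M) \<le> ennreal C"
    if n: "n \<ge> 1" and t: "\<bar>t\<bar> \<le> T" for n t
  proof -
    have A: "(\<integral>\<^sup>+\<omega>. ennreal (\<bar>?A n t \<omega>\<bar> ^ N) \<partial>M) \<le> ennreal (K N * b)"
      unfolding K_def b_def abs_idempotent
    proof (rule normalized_sum_moment_bound_bounded[OF indep_vars_compose2[OF ind, of "\<lambda>_ x. cos (t * x) - psi0 t" "\<lambda>_. borel"] _ _ n])
      show "\<bar>cos (t * Z k \<omega>) - psi0 t\<bar> \<le> 2" for k \<omega>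
        using psi0_pos[of t] psi0_le_1[of t] cos_le_one[of "t * Z k \<omega>"] cos_ge_minus_one[of "t * Z k \<omega>"]
        by linarith
      have "integrable M (\<lambda>\<omega>. cos (t * Z k \<omega>))" for k
        by (rule integrable_const_bound[of _ 1]) auto
      then show "expectation (\<lambda>\<omega>. cos (t * Z k \<omega>) - psi0 t) = 0" for k
        using std_normal_cos_sin(1)[OF Z, of t k] by (simp add: prob_space)
    qed auto
    have A': "(\<integral>\<^sup>+\<omega>. ennreal (\<bar>?A' n t \<omega>\<bar> ^ N) \<partial>M) \<le> ennreal (K N * b)"
      unfolding K_def b_def abs_idempotent
    proof (rule normalized_sum_moment_bound_bounded[OF indep_vars_compose2[OF ind, of "\<lambda>_ x. sin (t * x)" "\<lambda>_. borel"] _ _ n])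
      show "\<bar>sin (t * Z k \<omega>)\<bar> \<le> 2" for k \<omega>
        by (rule order_trans[OF abs_sin_le_one]) simp
    qed (use std_normal_cos_sin(2)[OF Z] in auto)
    have B: "(\<integral>\<^sup>+\<omega>. ennreal (\<bar>?B n \<omega>\<bar> ^ N) \<partial>M) \<le> ennreal (K N * c)"
      unfolding K_def c_def abs_idempotent
    proof (rule normalized_sum_moment_bound_normal[OF ind Z _ _ _ n, of "\<lambda>x. x\<^sup>2 - 1"])
      show "\<bar>x\<^sup>2 - 1\<bar> \<le> x\<^sup>2 + 1" for x :: real by (auto simp: abs_le_iff)
    qed (use std_normal_second_moment[OF Z] in \<open>auto simp: prob_space\<close>)
    have G: "(\<integral>\<^sup>+\<omega>. ennreal (\<bar>?G n \<omega>\<bar> ^ j) \<partial>M) \<le> ennreal (K j * c)" for j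
      unfolding K_def c_def abs_idempotent
    proof (rule normalized_sum_moment_bound_normal[OF ind Z _ _ _ n, of "\<lambda>x. x"])
      show "\<bar>x\<bar> \<le> x\<^sup>2 + 1" for x :: real
        using sum_squares_bound[of "\<bar>x\<bar>" 1] by simp
    qed (use standard_normal_distributed_expectation[OF Z] in auto)
    have G2: "(\<integral>\<^sup>+\<omega>. ennreal (\<bar>?G n \<omega> ^ 2\<bar> ^ N) \<partial>M) \<le> ennreal (K (2 * N) * c)"
      using G[of "2 * N"] by (simp add: power_mult)
    let ?R = "\<lambda>\<omega>. ?A n t \<omega> + ?A' n t \<omega> + T * ?B n \<omega> + T * ?G n \<omega> ^ 2 + T * ?G n \<omega>"
    have "(\<integral>\<^sup>+\<omega>. ennreal (cmod (Uproc Z n \<omega> t) ^ N) \<partial>M) \<le> (\<integral>\<^sup>+\<omega>. ennreal (\<bar>?R \<omega>\<bar> ^ N) \<partial>M)"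
      by (intro nn_integral_mono ennreal_leI power_mono order_trans[OF norm_Uproc_le[OF n t]] abs_ge_self) auto
    also have "\<dots> \<le> ennreal C"
      unfolding C_def
      by (intro nn_integral_power_add_le nn_integral_power_cmult_le A A' B G G2)
        (use K0 T in auto)
    finally show ?thesis .
  qed
  show ?thesis using C0 main by blast
qed

lemma Uproc_moment_bound:
  fixes X :: "nat \<Rightarrow> 'a \<Rightarrow> real"
  assumes ind: "indep_vars (\<lambda>_. borel) X UNIV"
    and X: "\<And>k. distributed M lborel (X k) (normal_density \<mu> \<sigma>)"
    and \<sigma>: "\<sigma> > 0" and T: "T \<ge> 0"
  shows "\<exists>C\<ge>0. \<forall>n\<ge>1. \<forall>t. \<bar>t\<bar> \<le> T \<longrightarrow>
    (\<integral>\<^sup>+\<omega>. ennreal (cmod (Uproc X n \<omega> t) ^ N) \<partial>M) \<le> ennreal C"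
proof -
  let ?Z = "\<lambda>k \<omega>. (X k \<omega> - \<mu>) / \<sigma>"
  have "indep_vars (\<lambda>_. borel) ?Z UNIV"
    by (rule indep_vars_compose2[OF ind, of "\<lambda>_ x. (x - \<mu>) / \<sigma>"]) auto
  moreover have "distributed M lborel (?Z k) std_normal_density" for k
    using X[of k] normal_standard_normal_convert[OF \<sigma>] by blast
  ultimately obtain C where C: "C \<ge> 0" "\<And>n t. n \<ge> 1 \<Longrightarrow> \<bar>t\<bar> \<le> T \<Longrightarrow>
      (\<integral>\<^sup>+\<omega>. ennreal (cmod (Uproc ?Z n \<omega> t) ^ N) \<partial>M) \<le> ennreal C"
    using Uproc_moment_bound_std[OF _ _ T, of ?Z N] by blast
  have "Uproc ?Z n \<omega> t = Uproc X n \<omega> t" if "n \<ge> 1" for n \<omega> t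
    unfolding Uproc_def ecf_std_affine_invariant[OF \<sigma> that] ..
  then show ?thesis using C by auto
qed

end

section \<open>Linearisation of the self-similarity discrepancy\<close>

text \<open>The remainder \<open>?R\<close> satisfies a recursion: it is multiplied by
  \<open>b\<close> and gains \<open>(a - b) * (a ^ Suc k - b ^ Suc k)\<close>, which is at most
  \<open>Suc k\<close> times the squared distance on the unit disc. The coefficients then add up
  within \<open>(Suc k)\<^sup>2\<close>.\<close>

lemma norm_power_diff_linear_le:
  fixes a b :: complex
  assumes a: "norm a \<le> 1" and b: "norm b \<le> 1"
  shows "norm (a ^ Suc k - b ^ Suc k - of_nat (Suc k) * b ^ k * (a - b)) \<le> (real (Suc k))\<^sup>2 * (norm (a - b))\<^sup>2"
proof (induction k)
  case (Suc k)
  let ?d = "norm (a - b)"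
  let ?R = "a ^ Suc k - b ^ Suc k - of_nat (Suc k) * b ^ k * (a - b)"
  have "a ^ Suc (Suc k) - b ^ Suc (Suc k) - of_nat (Suc (Suc k)) * b ^ Suc k * (a - b)
      = b * ?R + (a - b) * (a ^ Suc k - b ^ Suc k)"
    by (simp add: algebra_simps)
  also have "norm \<dots> \<le> norm b * norm ?R + ?d * norm (a ^ Suc k - b ^ Suc k)"
    unfolding norm_mult[symmetric] by (rule norm_triangle_ineq)
  also have "\<dots> \<le> 1 * ((real (Suc k))\<^sup>2 * ?d\<^sup>2) + ?d * (real (Suc k) * ?d)"
    using norm_power_diff[OF a b, of "Suc k"] Suc b
    by (intro add_mono mult_mono) auto
  also have "\<dots> \<le> (real (Suc (Suc k)))\<^sup>2 * ?d\<^sup>2"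
  proof -
    have "((real (Suc k))\<^sup>2 + real (Suc k)) * ?d\<^sup>2 \<le> (real (Suc (Suc k)))\<^sup>2 * ?d\<^sup>2"
      by (rule mult_right_mono) (auto simp: power2_eq_square algebra_simps)
    then show ?thesis by (simp add: power2_eq_square algebra_simps)
  qed
  finally show ?case .
qed simp

text \<open>Stability of the normal law: \<open>psi0\<close> is a fixed point of the self-similarity
  map for every \<open>m\<close>, so \<open>Spow X m\<close> and \<open>Spow X (m + 1)\<close> have
  the same centring.\<close>

lemma psi0_scaled_power:
  assumes "m \<ge> 1"
  shows "psi0 (t / sqrt (real m)) ^ m = psi0 t"
  using assms by (simp add: psi0_def exp_of_nat_mult[symmetric] power_divide)

text \<open>\<open>A\<close> is the scaled error of the power and \<open>L\<close> its first-order
  part. The first two bounds are Lipschitz estimates; the third is the quadratic remainder, where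
  \<open>sqrt n\<close> times the squared distance equals
  \<open>(cmod u)\<^sup>2 / sqrt n\<close>.\<close>

lemma Spow_linearization:
  fixes X :: "nat \<Rightarrow> 'a \<Rightarrow> real" and \<omega> :: 'a and t :: real and m n :: nat
  assumes n: "n \<ge> 1" and m: "m \<ge> 1"
  defines "u \<equiv> Uproc X n \<omega> (t / sqrt (real m))"
    and "A \<equiv> complex_of_real (sqrt (real n)) * (Spow X m n \<omega> t - complex_of_real (psi0 t))"
    and "L \<equiv> complex_of_real (psi0 t) *
      (of_nat m * Uproc X n \<omega> (t / sqrt (real m)) / complex_of_real (psi0 (t / sqrt (real m))))"
  shows "cmod A \<le> real m * cmod u"
    and "cmod L \<le> real m * cmod u"
    and "cmod (A - L) \<le> (real m)\<^sup>2 / sqrt (real n) * (cmod u)\<^sup>2"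
proof -
  define a where "a = ecf_std X n \<omega> (t / sqrt (real m))"
  define b where "b = psi0 (t / sqrt (real m))"
  let ?b = "complex_of_real b"
  have a1: "cmod a \<le> 1" unfolding a_def by (rule norm_ecf_std_le_1)
  have b01: "0 < b" "b \<le> 1" unfolding b_def by (rule psi0_pos, rule psi0_le_1)
  then have b1: "cmod ?b \<le> 1" by simp
  obtain k where k: "m = Suc k" using m by (cases m) auto
  have bm: "psi0 t = b ^ m" unfolding b_def using psi0_scaled_power[OF m] by simp
  have u: "u = sqrt n * (a - b)" unfolding u_def Uproc_def a_def b_def ..
  have S: "Spow X m n \<omega> t = a ^ m" unfolding Spow_def a_def ..
  have r: "sqrt (real n) > 0" "sqrt (real n) * sqrt (real n) = n" using n by auto
  \<comment> \<open>With \<open>psi0 t = b ^ m\<close>, the division by \<open>b\<close> leaves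
    \<open>b ^ k\<close>, the derivative coefficient of the \<open>m\<close>-th power at
    \<open>b\<close>.\<close>
  have L: "L = sqrt n * (of_nat m * ?b ^ k * (a - ?b))"
  proof -
    have "L = ?b ^ m * (of_nat m * u / ?b)"
      unfolding L_def bm u_def b_def[symmetric] by simp
    then show ?thesis using b01 unfolding u k by simp
  qed
  show "cmod A \<le> real m * cmod (u)"
    unfolding A_def S bm u norm_mult using norm_power_diff[OF a1 b1, of m]
    by (simp add: mult.left_commute[of "real m"] mult_left_mono)
  show "cmod (L) \<le> real m * cmod (u)"
  proof -
    have "cmod (L) = b ^ k * (m * cmod (u))"
      unfolding L u using b01 by (simp add: norm_mult norm_power)
    also have "\<dots> \<le> 1 * (m * cmod (u))"
      by (rule mult_right_mono) (use b01 in \<open>auto simp: power_le_one\<close>)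
    finally show ?thesis by simp
  qed
  have "A - L = sqrt n * (a ^ m - ?b ^ m - of_nat m * ?b ^ k * (a - ?b))"
    unfolding A_def L S bm by (simp add: algebra_simps)
  also have "cmod \<dots> \<le> sqrt n * ((real m)\<^sup>2 * (cmod (a - ?b))\<^sup>2)"
    using norm_power_diff_linear_le[OF a1 b1, of k] unfolding norm_mult k
    by (simp add: mult_left_mono)
  also have "\<dots> = (real m)\<^sup>2 / sqrt n * (cmod (u))\<^sup>2"
    unfolding u norm_mult using r by (simp add: power_mult_distrib field_simps)
  finally show "cmod (A - L) \<le> (real m)\<^sup>2 / sqrt n * (cmod (u))\<^sup>2" .
qed

text \<open>A common majorant for the two rescaled arguments entering \<open>Dfun\<close> and
  \<open>Hfun\<close>; a sum rather than a maximum, so that its moments follow from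
  \<open>nn_integral_power_add_le\<close>.\<close>

definition Uenv :: "(nat \<Rightarrow> 'a \<Rightarrow> real) \<Rightarrow> nat \<Rightarrow> nat \<Rightarrow> 'a \<Rightarrow> real \<Rightarrow> real" where
  "Uenv X m n \<omega> t = cmod (Uproc X n \<omega> (t / sqrt (real (m + 1)))) + cmod (Uproc X n \<omega> (t / sqrt (real m)))"

lemma Uenv_nonneg: "0 \<le> Uenv X m n \<omega> t"
  by (simp add: Uenv_def)

text \<open>Apply \<open>Spow_linearization\<close> at \<open>m\<close> and \<open>m + 1\<close> and
  subtract. The first two bounds give moments and integrability, the third is the pointwise
  linearisation error.\<close>

lemma Dfun_bounds:
  assumes n: "n \<ge> 1" and m: "m \<ge> 1"
  shows "real n * (cmod (Dfun X m n \<omega> t))\<^sup>2 \<le> (real (m + 1) * Uenv X m n \<omega> t)\<^sup>2"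
    and "(psi0 t * cmod (Hfun X m n \<omega> t))\<^sup>2 \<le> (real (m + 1) * Uenv X m n \<omega> t)\<^sup>2"
    and "\<bar>real n * (cmod (Dfun X m n \<omega> t))\<^sup>2 - (psi0 t)\<^sup>2 * (cmod (Hfun X m n \<omega> t))\<^sup>2\<bar>
      \<le> 2 * real (m + 1) ^ 3 / sqrt (real n) * Uenv X m n \<omega> t ^ 3"
proof -
  let ?F = "Uenv X m n \<omega> t"
  let ?r = "sqrt (real n)"
  define u where "u j = cmod (Uproc X n \<omega> (t / sqrt (real j)))" for j :: nat
  define A where "A j = ?r * (Spow X j n \<omega> t - psi0 t)" for j
  define L where "L j = psi0 t * (of_nat j * Uproc X n \<omega> (t / sqrt (real j)) / complex_of_real (psi0 (t / sqrt (real j))))" for j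
  have F: "?F = u (m + 1) + u m" unfolding Uenv_def u_def ..
  have u0: "u j \<ge> 0" for j unfolding u_def by simp
  have A: "cmod (A j) \<le> real j * u j" and Lb: "cmod (L j) \<le> real j * u j"
    and AL: "cmod (A j - L j) \<le> (real j)\<^sup>2 / ?r * (u j)\<^sup>2" if "j \<ge> 1" for j
    unfolding A_def L_def u_def by (rule Spow_linearization[OF n that])+
  define x where "x = ?r * Dfun X m n \<omega> t"
  define y where "y = psi0 t * Hfun X m n \<omega> t"
  \<comment> \<open>The common centring \<open>psi0 t\<close> cancels in the difference of the two
    powers.\<close>
  have x: "x = A (m + 1) - A m" unfolding x_def A_def Dfun_def by (simp add: algebra_simps)
  have y: "y = L (m + 1) - L m" unfolding y_def L_def Hfun_def by (simp add: right_diff_distrib)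
  have x2: "(cmod x)\<^sup>2 = real n * (cmod (Dfun X m n \<omega> t))\<^sup>2"
    unfolding x_def by (simp add: norm_mult power_mult_distrib)
  have y': "cmod y = psi0 t * cmod (Hfun X m n \<omega> t)"
    unfolding y_def using psi0_pos[of t] by (simp add: norm_mult)
  have lin: "real (m + 1) * u (m + 1) + real m * u m \<le> real (m + 1) * ?F"
    unfolding F using u0[of m] by (simp add: algebra_simps)
  have xb: "cmod x \<le> real (m + 1) * ?F"
    unfolding x using A[of "m + 1"] A[OF m] norm_triangle_ineq4[of "A (m + 1)" "A m"] lin by simp
  have yb: "cmod y \<le> real (m + 1) * ?F"
    unfolding y using Lb[of "m + 1"] Lb[OF m] norm_triangle_ineq4[of "L (m + 1)" "L m"] lin by simp
  show "real n * (cmod (Dfun X m n \<omega> t))\<^sup>2 \<le> (real (m + 1) * ?F)\<^sup>2"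
    unfolding x2[symmetric] by (rule power_mono[OF xb]) simp
  show "(psi0 t * cmod (Hfun X m n \<omega> t))\<^sup>2 \<le> (real (m + 1) * ?F)\<^sup>2"
    unfolding y'[symmetric] by (rule power_mono[OF yb]) simp
  have "x - y = (A (m + 1) - L (m + 1)) - (A m - L m)" unfolding x y by simp
  then have "cmod (x - y) \<le> cmod (A (m + 1) - L (m + 1)) + cmod (A m - L m)"
    by (metis norm_triangle_ineq4)
  also have "\<dots> \<le> (real (m + 1))\<^sup>2 / ?r * (u (m + 1))\<^sup>2 + (real m)\<^sup>2 / ?r * (u m)\<^sup>2"
    using AL[of "m + 1"] AL[OF m] by simp
  also have "\<dots> \<le> (real (m + 1))\<^sup>2 / ?r * (u (m + 1))\<^sup>2 + (real (m + 1))\<^sup>2 / ?r * (u m)\<^sup>2"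
    by (intro add_left_mono mult_right_mono divide_right_mono power_mono) auto
  also have "\<dots> = (real (m + 1))\<^sup>2 / ?r * ((u (m + 1))\<^sup>2 + (u m)\<^sup>2)" by (simp only: distrib_left)
  also have "\<dots> \<le> (real (m + 1))\<^sup>2 / ?r * ?F\<^sup>2"
    unfolding F using u0[of m] u0[of "m + 1"] by (intro mult_left_mono) (auto simp: power2_sum)
  finally have xy: "cmod (x - y) \<le> (real (m + 1))\<^sup>2 / ?r * ?F\<^sup>2" .
  \<comment> \<open>Difference of squares: the first factor is quadratic in \<open>?F\<close> with
    the gain \<open>1 / ?r\<close>, the second is linear in \<open>?F\<close>; together they produce
    the cube.\<close>
  have "\<bar>(cmod x)\<^sup>2 - (cmod y)\<^sup>2\<bar> = \<bar>cmod x - cmod y\<bar> * (cmod x + cmod y)"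
    by (simp add: power2_eq_square square_diff_square_factored abs_mult)
  also have "\<dots> \<le> (real (m + 1))\<^sup>2 / ?r * ?F\<^sup>2 * (real (m + 1) * ?F + real (m + 1) * ?F)"
    using norm_triangle_ineq3[of x y] xy xb yb by (intro mult_mono add_mono) auto
  also have "\<dots> = 2 * real (m + 1) ^ 3 / ?r * ?F ^ 3"
    by (simp add: power2_eq_square power3_eq_cube algebra_simps)
  finally show "\<bar>real n * (cmod (Dfun X m n \<omega> t))\<^sup>2 - (psi0 t)\<^sup>2 * (cmod (Hfun X m n \<omega> t))\<^sup>2\<bar>
      \<le> 2 * real (m + 1) ^ 3 / ?r * ?F ^ 3"
    unfolding x2 y' power_mult_distrib by simp
qed

text \<open>A deterministic bound, growing with \<open>n\<close>; it only secures integrability in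
  \<open>t\<close> for each fixed \<open>n\<close>.\<close>

lemma Uenv_le: "Uenv X m n \<omega> t \<le> 4 * sqrt n"
proof -
  have "cmod (Uproc X n \<omega> s) \<le> sqrt n * 2" for s
  proof -
    have "cmod (ecf_std X n \<omega> s - psi0 s) \<le> 1 + 1"
      using norm_triangle_ineq4[of "ecf_std X n \<omega> s" "complex_of_real (psi0 s)"]
        norm_ecf_std_le_1[of X n \<omega> s] psi0_pos[of s] psi0_le_1[of s] by simp
    then show ?thesis unfolding Uproc_def norm_mult by (simp add: mult_left_mono)
  qed
  from this[of "t / sqrt (real (m + 1))"] this[of "t / sqrt (real m)"]
  show ?thesis unfolding Uenv_def by linarith
qed

section \<open>Integration over bounded intervals\<close>

lemma borel_measurable_cis [measurable (raw)]:
  assumes "f \<in> borel_measurable M"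
  shows "(\<lambda>x. cis (f x)) \<in> borel_measurable M"
  unfolding cis_conv_exp using assms by measurable

text \<open>Composition with arbitrary \<open>f\<close> and \<open>g\<close> lets one rule yield
  joint measurability in both variables as well as measurability of the sections.\<close>

lemma ecf_std_measurable:
  fixes X :: "nat \<Rightarrow> 'a \<Rightarrow> real"
  assumes [measurable]: "\<And>k. X k \<in> borel_measurable M"
    and [measurable]: "f \<in> measurable N M" "g \<in> borel_measurable N"
  shows "(\<lambda>x. ecf_std X n (f x) (g x)) \<in> borel_measurable N"
  unfolding ecf_std_def ecf_def ssd_def smean_def by measurable

lemma psi0_measurable [measurable]: "psi0 \<in> borel_measurable borel"
  unfolding psi0_def[abs_def] by measurable

text \<open>Convexity of the power on the half-line. In the induction, multiplying the tangent bound
  by \<open>x\<close> overshoots the next tangent by a nonnegative multiple of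
  \<open>(x - a)\<^sup>2\<close>.\<close>

lemma power_ge_tangent:
  fixes x a :: real
  assumes "0 \<le> x" "0 \<le> a"
  shows "a ^ Suc N + real (Suc N) * a ^ N * (x - a) \<le> x ^ Suc N"
proof (induction N)
  case (Suc N)
  have "a ^ Suc (Suc N) + real (Suc (Suc N)) * a ^ Suc N * (x - a) =
      x * (a ^ Suc N + real (Suc N) * a ^ N * (x - a)) - real (Suc N) * a ^ N * (x - a)\<^sup>2"
    by (simp add: algebra_simps power2_eq_square)
  also have "\<dots> \<le> x * (a ^ Suc N + real (Suc N) * a ^ N * (x - a))" using assms by simp
  also have "\<dots> \<le> x * x ^ Suc N" using Suc assms by (intro mult_left_mono) auto
  finally show ?case by simp
qed simp

lemma set_integrable_bounded_interval:
  fixes f :: "real \<Rightarrow> real"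
  assumes [measurable]: "f \<in> borel_measurable borel" and "\<And>t. \<bar>f t\<bar> \<le> K"
  shows "set_integrable lborel {a..b} f"
  unfolding set_integrable_def
proof (rule Bochner_Integration.integrable_bound[where f = "\<lambda>t. K * indicator {a..b} t"])
  show "AE t in lborel. norm (indicator {a..b} t *\<^sub>R f t) \<le> norm (K * indicator {a..b} t)"
    by (intro AE_I2) (use assms(2) in \<open>auto simp: indicator_def intro: order_trans[OF _ abs_ge_self]\<close>)
qed (auto intro!: integrable_real_indicator simp: emeasure_lborel_Icc_eq)

text \<open>Jensen's inequality for the uniform distribution on \<open>{-T..T}\<close>, obtained by
  integrating a tangent inequality.\<close>

lemma set_integral_power_le:
  fixes f :: "real \<Rightarrow> real"
  assumes [measurable]: "f \<in> borel_measurable borel"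
    and f0: "\<And>t. 0 \<le> f t" and fK: "\<And>t. f t \<le> K" and T: "T > 0"
  shows "(\<integral>t\<in>{-T..T}. f t \<partial>lborel) ^ Suc N \<le> (2 * T) ^ N * (\<integral>t\<in>{-T..T}. f t ^ Suc N \<partial>lborel)"
proof -
  define I where "I = (\<integral>t\<in>{-T..T}. f t \<partial>lborel)"
  \<comment> \<open>The tangent point is the average of \<open>f\<close>, so the linear term
    integrates to zero.\<close>
  define a where "a = I / (2 * T)"
  have I0: "I \<ge> 0" unfolding I_def set_lebesgue_integral_def by (rule Bochner_Integration.integral_nonneg) (use f0 in auto)
  then have a0: "a \<ge> 0" unfolding a_def using T by simp
  have intf: "set_integrable lborel {-T..T} f"
    by (rule set_integrable_bounded_interval[where K = K]) (use f0 fK in auto)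
  have intp: "set_integrable lborel {-T..T} (\<lambda>t. f t ^ Suc N)"
    by (rule set_integrable_bounded_interval[where K = "K ^ Suc N"])
      (use f0 fK in \<open>auto simp del: power_Suc simp: power_abs[symmetric] intro!: power_mono\<close>)
  have intc: "set_integrable lborel {-T..T} (\<lambda>t. c)" for c :: real
    by (rule set_integrable_bounded_interval[where K = "\<bar>c\<bar>"]) auto
  let ?c = "real (Suc N) * a ^ N"
  have "(\<integral>t\<in>{-T..T}. (a ^ Suc N - ?c * a) + ?c * f t \<partial>lborel) = 2 * T * (a ^ Suc N - ?c * a) + ?c * I"
    using T unfolding I_def
    by (subst set_integral_add) (auto simp: intc intf set_integral_const algebra_simps)
  also have "\<dots> = 2 * T * a ^ Suc N"
    using T unfolding a_def by (simp add: field_simps)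
  finally have "2 * T * a ^ Suc N = (\<integral>t\<in>{-T..T}. (a ^ Suc N - ?c * a) + ?c * f t \<partial>lborel)" ..
  also have "\<dots> \<le> (\<integral>t\<in>{-T..T}. f t ^ Suc N \<partial>lborel)"
    using power_ge_tangent[OF f0 a0, of N]
    by (intro set_integral_mono set_integral_add intc intp set_integrable_mult_right intf)
      (simp add: algebra_simps)
  finally have "(2 * T) ^ N * (2 * T * a ^ Suc N) \<le> (2 * T) ^ N * (\<integral>t\<in>{-T..T}. f t ^ Suc N \<partial>lborel)"
    using T by (intro mult_left_mono) auto
  moreover have "(2 * T) ^ N * (2 * T * a ^ Suc N) = I ^ Suc N"
  proof -
    have "(2 * T) ^ N * (2 * T * a ^ Suc N) = (2 * T * a) ^ Suc N"
      by (simp only: power_mult_distrib power_Suc ac_simps)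
    then show ?thesis using T by (simp add: a_def)
  qed
  ultimately show ?thesis unfolding I_def by (simp only:)
qed

section \<open>Fubini for expected integrals, and Markov's inequality\<close>

context prob_space
begin

text \<open>Exchange of the two nonnegative integrals turns a moment bound uniform in
  \<open>t\<close> into a bound for the integral. The bound \<open>K\<close> identifies the inner
  Lebesgue integral with its extended version and does not enter the result.\<close>

lemma nn_integral_set_integral_le:
  fixes f :: "'a \<Rightarrow> real \<Rightarrow> real"
  assumes f[measurable]: "(\<lambda>(\<omega>, t). f \<omega> t) \<in> borel_measurable (M \<Otimes>\<^sub>M lborel)"
    and f0: "\<And>\<omega> t. 0 \<le> f \<omega> t" and fK: "\<And>\<omega> t. f \<omega> t \<le> K"
    and C: "\<And>t. \<bar>t\<bar> \<le> T \<Longrightarrow> (\<integral>\<^sup>+\<omega>. ennreal (f \<omega> t) \<partial>M) \<le> ennreal C" and C0: "0 \<le> C"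
    and T: "T > 0"
  shows "(\<integral>\<^sup>+\<omega>. ennreal (\<integral>t\<in>{-T..T}. f \<omega> t \<partial>lborel) \<partial>M) \<le> ennreal (2 * T * C)"
proof -
  interpret P: pair_sigma_finite M lborel by unfold_locales
  have "(\<integral>\<^sup>+\<omega>. ennreal (\<integral>t\<in>{-T..T}. f \<omega> t \<partial>lborel) \<partial>M) =
      (\<integral>\<^sup>+\<omega>. (\<integral>\<^sup>+t. indicator {-T..T} t * ennreal (f \<omega> t) \<partial>lborel) \<partial>M)"
  proof (rule nn_integral_cong)
    fix \<omega> assume \<omega>[simp]: "\<omega> \<in> space M"
    have [measurable]: "f \<omega> \<in> borel_measurable borel"
      using measurable_Pair2[OF f \<omega>] by simp
    have "set_integrable lborel {-T..T} (f \<omega>)"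
      by (rule set_integrable_bounded_interval[where K = K]) (use f0 fK in auto)
    then have "ennreal (\<integral>t\<in>{-T..T}. f \<omega> t \<partial>lborel) = (\<integral>\<^sup>+t. ennreal (indicator {-T..T} t *\<^sub>R f \<omega> t) \<partial>lborel)"
      unfolding set_lebesgue_integral_def set_integrable_def
      by (intro nn_integral_eq_integral[symmetric]) (use f0 in auto)
    also have "\<dots> = (\<integral>\<^sup>+t. indicator {-T..T} t * ennreal (f \<omega> t) \<partial>lborel)"
      by (intro nn_integral_cong) (auto simp: indicator_def)
    finally show "ennreal (\<integral>t\<in>{-T..T}. f \<omega> t \<partial>lborel) = (\<integral>\<^sup>+t. indicator {-T..T} t * ennreal (f \<omega> t) \<partial>lborel)" .
  qed
  also have "\<dots> = (\<integral>\<^sup>+t. (\<integral>\<^sup>+\<omega>. indicator {-T..T} t * ennreal (f \<omega> t) \<partial>M) \<partial>lborel)"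
    by (rule P.Fubini'[symmetric]) measurable
  also have "\<dots> \<le> (\<integral>\<^sup>+t. ennreal C * indicator {-T..T} t \<partial>lborel)"
    by (intro nn_integral_mono) (use C in \<open>auto simp: indicator_def\<close>)
  also have "\<dots> = ennreal (2 * T * C)"
    using T C0 by (subst nn_integral_cmult_indicator) (auto simp: ennreal_mult[symmetric] mult.commute)
  finally show ?thesis .
qed

lemma prob_abs_gt_le:
  fixes W :: "'a \<Rightarrow> real"
  assumes [measurable]: "W \<in> borel_measurable M"
    and C: "(\<integral>\<^sup>+\<omega>. ennreal \<bar>W \<omega>\<bar> \<partial>M) \<le> ennreal C" "0 \<le> C" and K: "K > 0"
  shows "prob {\<omega> \<in> space M. K < \<bar>W \<omega>\<bar>} \<le> C / K"
proof -
  have "emeasure M {\<omega> \<in> space M. K < \<bar>W \<omega>\<bar>} = (\<integral>\<^sup>+\<omega>. indicator {\<omega> \<in> space M. K < \<bar>W \<omega>\<bar>} \<omega> \<partial>M)"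
    by simp
  also have "\<dots> \<le> (\<integral>\<^sup>+\<omega>. ennreal (1 / K) * ennreal \<bar>W \<omega>\<bar> \<partial>M)"
    using K by (intro nn_integral_mono)
      (auto simp: indicator_def ennreal_mult[symmetric] simp del: ennreal_1 simp: ennreal_1[symmetric] intro!: ennreal_leI)
  also have "\<dots> = ennreal (1 / K) * (\<integral>\<^sup>+\<omega>. ennreal \<bar>W \<omega>\<bar> \<partial>M)" by (rule nn_integral_cmult) simp
  also have "\<dots> \<le> ennreal (1 / K) * ennreal C" using C by (intro mult_left_mono) auto
  also have "\<dots> = ennreal (C / K)" using K C by (simp add: ennreal_mult[symmetric])
  finally show ?thesis using K C by (simp add: emeasure_eq_measure)
qed

end

text \<open>Below 1 the constant dominates, above 1 the larger exponent. Moments of real order thus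
  reduce to integer ones.\<close>

lemma powr_le_one_plus_power:
  fixes x p :: real
  assumes "0 \<le> x" "0 < p" "p \<le> real N"
  shows "x powr p \<le> 1 + x ^ N"
proof (cases "x \<le> 1")
  case True
  then have "x powr p \<le> 1" using assms by (intro powr_le1) auto
  then show ?thesis using assms by (simp add: add_increasing2)
next
  case False
  then have "x powr p \<le> x powr real N" using assms by (intro powr_mono) auto
  then show ?thesis using False by (simp add: powr_realpow)
qed

section \<open>Normal samples\<close>

text \<open>One pair \<open>m\<close>, \<open>T\<close> is fixed. The weight is abstracted to a
  measurable function with values in the unit interval, so it can be bounded by 1 wherever an
  integrand is majorised.\<close>

locale normal_sample = prob_space M for M :: "'a measure" +
  fixes X :: "nat \<Rightarrow> 'a \<Rightarrow> real" and \<mu> \<sigma> T :: real and m :: nat and w :: "real \<Rightarrow> real"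
  assumes indep: "indep_vars (\<lambda>_. borel) X UNIV"
    and normal: "\<And>k. distributed M lborel (X k) (normal_density \<mu> \<sigma>)"
    and \<sigma>_pos: "\<sigma> > 0" and T_pos: "T > 0" and m_pos: "m \<ge> 1"
    and w_measurable [measurable]: "w \<in> borel_measurable borel"
    and w_nonneg: "\<And>t. 0 \<le> w t" and w_le_1: "\<And>t. w t \<le> 1"
begin

section \<open>Measurability of the processes and of their integrals\<close>

lemma X_measurable [measurable]: "X k \<in> borel_measurable M"
  using indep by (auto simp: indep_vars_def)

lemmas ecf_std_X_measurable [measurable (raw)] = ecf_std_measurable[OF X_measurable]

lemma Uproc_measurable [measurable (raw)]:
  assumes [measurable]: "f \<in> measurable N M" "g \<in> borel_measurable N"
  shows "(\<lambda>x. Uproc X n (f x) (g x)) \<in> borel_measurable N"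
  unfolding Uproc_def by measurable

lemma Dfun_measurable [measurable (raw)]:
  assumes [measurable]: "f \<in> measurable N M" "g \<in> borel_measurable N"
  shows "(\<lambda>x. Dfun X m n (f x) (g x)) \<in> borel_measurable N"
  unfolding Dfun_def Spow_def by measurable

lemma Hfun_measurable [measurable (raw)]:
  assumes [measurable]: "f \<in> measurable N M" "g \<in> borel_measurable N"
  shows "(\<lambda>x. Hfun X m n (f x) (g x)) \<in> borel_measurable N"
  unfolding Hfun_def by measurable

lemma Uenv_measurable [measurable (raw)]:
  assumes [measurable]: "f \<in> measurable N M" "g \<in> borel_measurable N"
  shows "(\<lambda>x. Uenv X m n (f x) (g x)) \<in> borel_measurable N"
  unfolding Uenv_def by measurable

text \<open>This is \<open>n\<close> times the leading term, so that
  \<open>real n * Delta w T X m n \<omega> - Hint n \<omega>\<close> is the remainder scaled by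
  \<open>n\<close>.\<close>

definition Hint :: "nat \<Rightarrow> 'a \<Rightarrow> real" where
  "Hint n \<omega> = (\<integral>t\<in>{-T..T}. w t * (psi0 t)\<^sup>2 * (cmod (Hfun X m n \<omega> t))\<^sup>2 \<partial>lborel)"

lemma Delta_measurable [measurable]: "Delta w T X m n \<in> borel_measurable M"
  unfolding Delta_def[abs_def] set_lebesgue_integral_def by measurable

lemma Hint_measurable [measurable]: "Hint n \<in> borel_measurable M"
  unfolding Hint_def[abs_def] set_lebesgue_integral_def by measurable

lemma Delta_nonneg: "0 \<le> Delta w T X m n \<omega>"
  unfolding Delta_def set_lebesgue_integral_def
  by (rule Bochner_Integration.integral_nonneg) (use w_nonneg in auto)

section \<open>Uniform moments of the scaled discrepancy\<close>

lemma Uenv_power_le: "Uenv X m n \<omega> t ^ N \<le> (4 * sqrt n) ^ N"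
  by (intro power_mono Uenv_le Uenv_nonneg)

text \<open>Division by \<open>sqrt (real j)\<close> with \<open>j \<ge> 1\<close> keeps the
  argument in \<open>{-T..T}\<close>, so the uniform moment bound for \<open>Uproc\<close> applies
  at both rescaled points.\<close>

lemma nn_integral_Uenv_power_le:
  "\<exists>C\<ge>0. \<forall>n\<ge>1. (\<integral>\<^sup>+\<omega>. ennreal (\<integral>t\<in>{-T..T}. Uenv X m n \<omega> t ^ N \<partial>lborel) \<partial>M) \<le> ennreal C"
proof -
  have T0: "T \<ge> 0" using T_pos by simp
  obtain C where C: "C \<ge> 0" "\<And>n t. n \<ge> 1 \<Longrightarrow> \<bar>t\<bar> \<le> T \<Longrightarrow>
      (\<integral>\<^sup>+\<omega>. ennreal (cmod (Uproc X n \<omega> t) ^ N) \<partial>M) \<le> ennreal C"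
    using Uproc_moment_bound[OF indep normal \<sigma>_pos T0, of N] by blast
  have main: "(\<integral>\<^sup>+\<omega>. ennreal (\<integral>t\<in>{-T..T}. Uenv X m n \<omega> t ^ N \<partial>lborel) \<partial>M) \<le> ennreal (2 * T * (2 ^ N * (C + C)))"
    if n: "n \<ge> 1" for n
  proof (rule nn_integral_set_integral_le[where K = "(4 * sqrt n) ^ N"])
    fix t :: real assume t: "\<bar>t\<bar> \<le> T"
    have s: "\<bar>t / sqrt (real j)\<bar> \<le> T" if "j \<ge> 1" for j :: nat
    proof -
      have "\<bar>t\<bar> / sqrt (real j) \<le> \<bar>t\<bar> / 1" using that by (intro divide_left_mono) auto
      then show ?thesis using t by (simp add: abs_divide)
    qed
    have "(\<integral>\<^sup>+\<omega>. ennreal (\<bar>cmod (Uproc X n \<omega> (t / sqrt (real (m + 1)))) + cmod (Uproc X n \<omega> (t / sqrt (real m)))\<bar> ^ N) \<partial>M)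
        \<le> ennreal (2 ^ N * (C + C))"
      using C(2)[OF n s[of "m + 1"]] C(2)[OF n s[OF m_pos]]
      by (intro nn_integral_power_add_le C(1)) auto
    then show "(\<integral>\<^sup>+\<omega>. ennreal (Uenv X m n \<omega> t ^ N) \<partial>M) \<le> ennreal (2 ^ N * (C + C))"
      by (simp add: Uenv_def)
  next
    show "(\<lambda>(\<omega>, t). Uenv X m n \<omega> t ^ N) \<in> borel_measurable (M \<Otimes>\<^sub>M lborel)"
      by measurable
  qed (use C(1) T_pos Uenv_power_le in \<open>auto simp: Uenv_nonneg simp del: power_mult_distrib\<close>)
  show ?thesis
    by (rule exI[of _ "2 * T * (2 ^ N * (C + C))"]) (use main C(1) T_pos in auto)
qed

text \<open>The scaled discrepancy is at most the integral of a multiple of \<open>Uenv\<close>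
  squared; Jensen moves the outer power inside, leaving a moment of \<open>Uenv\<close> of order
  \<open>2 * Suc N\<close>.\<close>

lemma Delta_power_bound:
  "\<exists>C\<ge>0. \<forall>n\<ge>1. (\<integral>\<^sup>+\<omega>. ennreal ((real n * Delta w T X m n \<omega>) ^ Suc N) \<partial>M) \<le> ennreal C"
proof -
  obtain C where C: "C \<ge> 0" "\<And>n. n \<ge> 1 \<Longrightarrow>
      (\<integral>\<^sup>+\<omega>. ennreal (\<integral>t\<in>{-T..T}. Uenv X m n \<omega> t ^ (2 * Suc N) \<partial>lborel) \<partial>M) \<le> ennreal C"
    using nn_integral_Uenv_power_le[of "2 * Suc N"] by blast
  \<comment> \<open>The first factor is the Jensen constant, the second the power of
    \<open>(m + 1)\<^sup>2\<close> from \<open>Dfun_bounds\<close>.\<close>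
  define c where "c = (2 * T) ^ N * real (m + 1) ^ (2 * Suc N)"
  have c0: "c \<ge> 0" unfolding c_def using T_pos by simp
  have "(\<integral>\<^sup>+\<omega>. ennreal ((real n * Delta w T X m n \<omega>) ^ Suc N) \<partial>M) \<le> ennreal (c * C)" if n: "n \<ge> 1" for n
  proof -
    have "(real n * Delta w T X m n \<omega>) ^ Suc N \<le> c * (\<integral>t\<in>{-T..T}. Uenv X m n \<omega> t ^ (2 * Suc N) \<partial>lborel)"
      if \<omega>[measurable]: "\<omega> \<in> space M" for \<omega>
    proof -
      let ?G = "\<lambda>t. (real (m + 1) * Uenv X m n \<omega> t)\<^sup>2"
      define K where "K = (real (m + 1) * (4 * sqrt n))\<^sup>2"
      have GK: "?G t \<le> K" for t
        unfolding K_def by (intro power_mono mult_left_mono Uenv_le) (auto simp: Uenv_nonneg)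
      have DG: "w t * (real n * (cmod (Dfun X m n \<omega> t))\<^sup>2) \<le> ?G t" for t
      proof -
        have "w t * (real n * (cmod (Dfun X m n \<omega> t))\<^sup>2) \<le> 1 * ?G t"
          using Dfun_bounds(1)[OF n m_pos, of X \<omega> t] w_nonneg w_le_1 by (intro mult_mono) auto
        then show ?thesis by simp
      qed
      have "real n * Delta w T X m n \<omega> = (\<integral>t\<in>{-T..T}. w t * (real n * (cmod (Dfun X m n \<omega> t))\<^sup>2) \<partial>lborel)"
        unfolding Delta_def set_integral_mult_right[symmetric] by (simp add: ac_simps)
      also have "\<dots> \<le> (\<integral>t\<in>{-T..T}. ?G t \<partial>lborel)"
      proof (rule set_integral_mono[OF _ _ DG])
        show "set_integrable lborel {-T..T} (\<lambda>t. w t * (real n * (cmod (Dfun X m n \<omega> t))\<^sup>2))"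
          by (rule set_integrable_bounded_interval[where K = K])
            (use order_trans[OF DG GK] w_nonneg in \<open>auto simp: abs_mult\<close>)
        show "set_integrable lborel {-T..T} ?G"
          by (rule set_integrable_bounded_interval[where K = K]) (use GK in auto)
      qed
      finally have "(real n * Delta w T X m n \<omega>) ^ Suc N \<le> (\<integral>t\<in>{-T..T}. ?G t \<partial>lborel) ^ Suc N"
        by (intro power_mono) (auto simp: Delta_nonneg)
      also have "\<dots> \<le> (2 * T) ^ N * (\<integral>t\<in>{-T..T}. ?G t ^ Suc N \<partial>lborel)"
        by (rule set_integral_power_le[where K = K]) (use GK T_pos in auto)
      also have "(\<integral>t\<in>{-T..T}. ?G t ^ Suc N \<partial>lborel) =
          (\<integral>t\<in>{-T..T}. real (m + 1) ^ (2 * Suc N) * Uenv X m n \<omega> t ^ (2 * Suc N) \<partial>lborel)"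
        by (simp only: power_mult_distrib power_mult[symmetric])
      finally show ?thesis unfolding c_def by (simp only: set_integral_mult_right mult.assoc)
    qed
    then have "(\<integral>\<^sup>+\<omega>. ennreal ((real n * Delta w T X m n \<omega>) ^ Suc N) \<partial>M)
        \<le> (\<integral>\<^sup>+\<omega>. ennreal (c * (\<integral>t\<in>{-T..T}. Uenv X m n \<omega> t ^ (2 * Suc N) \<partial>lborel)) \<partial>M)"
      by (intro nn_integral_mono ennreal_leI)
    also have "\<dots> \<le> ennreal (c * C)"
      by (rule nn_integral_cmult_le[OF _ c0 C(1) C(2)[OF n]])
        (unfold set_lebesgue_integral_def, measurable)
    finally show ?thesis .
  qed
  then show ?thesis using c0 C(1) by (intro exI[of _ "c * C"]) auto
qed

lemma Delta_powr_bound: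
  assumes p: "p > 0"
  shows "\<exists>C\<ge>0. \<forall>n\<ge>1. (\<integral>\<^sup>+\<omega>. ennreal ((real n * Delta w T X m n \<omega>) powr p) \<partial>M) \<le> ennreal C"
proof -
  define N where "N = nat \<lceil>p\<rceil>"
  have N: "p \<le> real (Suc N)" unfolding N_def using of_nat_ceiling[of p] by linarith
  obtain C where C: "C \<ge> 0" "\<And>n. n \<ge> 1 \<Longrightarrow>
      (\<integral>\<^sup>+\<omega>. ennreal ((real n * Delta w T X m n \<omega>) ^ Suc N) \<partial>M) \<le> ennreal C"
    using Delta_power_bound by blast
  have "(\<integral>\<^sup>+\<omega>. ennreal ((real n * Delta w T X m n \<omega>) powr p) \<partial>M) \<le> ennreal (1 + C)" if n: "n \<ge> 1" for n
  proof -
    have "(\<integral>\<^sup>+\<omega>. ennreal ((real n * Delta w T X m n \<omega>) powr p) \<partial>M)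
        \<le> (\<integral>\<^sup>+\<omega>. 1 + ennreal ((real n * Delta w T X m n \<omega>) ^ Suc N) \<partial>M)"
    proof (rule nn_integral_mono)
      fix \<omega>
      let ?x = "real n * Delta w T X m n \<omega>"
      have "ennreal (?x powr p) \<le> ennreal (1 + ?x ^ Suc N)"
        by (intro ennreal_leI powr_le_one_plus_power p N) (simp add: Delta_nonneg)
      also have "\<dots> = 1 + ennreal (?x ^ Suc N)"
        by (subst ennreal_plus) (auto simp: Delta_nonneg)
      finally show "ennreal (?x powr p) \<le> 1 + ennreal (?x ^ Suc N)" .
    qed
    also have "\<dots> = 1 + (\<integral>\<^sup>+\<omega>. ennreal ((real n * Delta w T X m n \<omega>) ^ Suc N) \<partial>M)"
      by (subst nn_integral_add) (auto simp: emeasure_space_1)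
    also have "\<dots> \<le> 1 + ennreal C" by (intro add_left_mono C(2) n)
    also have "\<dots> = ennreal (1 + C)" using C(1) by simp
    finally show ?thesis .
  qed
  then show ?thesis using C(1) by (intro exI[of _ "1 + C"]) auto
qed

text \<open>An error bound in mean, stronger than convergence in probability: the cubic pointwise
  error is integrated against the third moment of \<open>Uenv\<close>.\<close>

lemma Delta_linearization_error:
  "\<exists>C\<ge>0. \<forall>n\<ge>1. (\<integral>\<^sup>+\<omega>. ennreal \<bar>real n * Delta w T X m n \<omega> - Hint n \<omega>\<bar> \<partial>M) \<le> ennreal (C / sqrt n)"
proof -
  obtain C where C: "C \<ge> 0" "\<And>n. n \<ge> 1 \<Longrightarrow>
      (\<integral>\<^sup>+\<omega>. ennreal (\<integral>t\<in>{-T..T}. Uenv X m n \<omega> t ^ 3 \<partial>lborel) \<partial>M) \<le> ennreal C"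
    using nn_integral_Uenv_power_le[of 3] by blast
  define d where "d = 2 * real (m + 1) ^ 3"
  have d0: "d \<ge> 0" unfolding d_def by simp
  have "(\<integral>\<^sup>+\<omega>. ennreal \<bar>real n * Delta w T X m n \<omega> - Hint n \<omega>\<bar> \<partial>M) \<le> ennreal (d * C / sqrt n)" if n: "n \<ge> 1" for n
  proof -
    have "\<bar>real n * Delta w T X m n \<omega> - Hint n \<omega>\<bar> \<le> d / sqrt n * (\<integral>t\<in>{-T..T}. Uenv X m n \<omega> t ^ 3 \<partial>lborel)"
      if \<omega>[measurable]: "\<omega> \<in> space M" for \<omega>
    proof -
      let ?F = "Uenv X m n \<omega>"
      let ?f = "\<lambda>t. w t * (real n * (cmod (Dfun X m n \<omega> t))\<^sup>2)"
      let ?h = "\<lambda>t. w t * (psi0 t)\<^sup>2 * (cmod (Hfun X m n \<omega> t))\<^sup>2"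
      define K where "K = (real (m + 1) * (4 * sqrt n))\<^sup>2"
      have GK: "(real (m + 1) * ?F t)\<^sup>2 \<le> K" for t
        unfolding K_def by (intro power_mono mult_left_mono Uenv_le) (auto simp: Uenv_nonneg)
      have fK: "\<bar>?f t\<bar> \<le> K" for t
      proof -
        have "?f t \<le> 1 * K"
          using order_trans[OF Dfun_bounds(1)[OF n m_pos, of X \<omega> t] GK] w_nonneg w_le_1
          by (intro mult_mono) auto
        then show ?thesis using w_nonneg[of t] by (simp add: abs_mult)
      qed
      have hK: "\<bar>?h t\<bar> \<le> K" for t
      proof -
        have "w t * ((psi0 t)\<^sup>2 * (cmod (Hfun X m n \<omega> t))\<^sup>2) \<le> 1 * K"
          using order_trans[OF Dfun_bounds(2)[OF n m_pos, of t X \<omega>] GK] w_nonneg w_le_1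
          by (intro mult_mono) (auto simp: power_mult_distrib)
        then show ?thesis using w_nonneg[of t] by (simp add: abs_mult mult.assoc)
      qed
      have intf: "set_integrable lborel {-T..T} ?f" and inth: "set_integrable lborel {-T..T} ?h"
        by (rule set_integrable_bounded_interval[OF _ fK], measurable,
            rule set_integrable_bounded_interval[OF _ hK], measurable)
      have intF: "set_integrable lborel {-T..T} (\<lambda>t. d / sqrt n * ?F t ^ 3)"
        by (intro set_integrable_mult_right set_integrable_bounded_interval[where K = "(4 * sqrt n) ^ 3"])
          (use Uenv_power_le[of n \<omega> _ 3] in \<open>auto simp: Uenv_nonneg\<close>)
      have fh: "\<bar>?f t - ?h t\<bar> \<le> d / sqrt n * ?F t ^ 3" for t
      proof -
        let ?e = "real n * (cmod (Dfun X m n \<omega> t))\<^sup>2 - (psi0 t)\<^sup>2 * (cmod (Hfun X m n \<omega> t))\<^sup>2"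
        have "\<bar>?f t - ?h t\<bar> = w t * \<bar>?e\<bar>"
          using w_nonneg[of t] by (simp add: right_diff_distrib[symmetric] abs_mult mult.assoc)
        also have "\<dots> \<le> 1 * (d / sqrt n * ?F t ^ 3)"
          using Dfun_bounds(3)[OF n m_pos, of X \<omega> t] w_nonneg w_le_1
          unfolding d_def by (intro mult_mono) auto
        finally show ?thesis by simp
      qed
      have "real n * Delta w T X m n \<omega> = (\<integral>t\<in>{-T..T}. ?f t \<partial>lborel)"
        unfolding Delta_def set_integral_mult_right[symmetric] by (simp add: ac_simps)
      then have "real n * Delta w T X m n \<omega> - Hint n \<omega> = (\<integral>t\<in>{-T..T}. ?f t - ?h t \<partial>lborel)"
        unfolding Hint_def using set_integral_diff(2)[OF intf inth] by simp
      also have "\<bar>\<dots>\<bar> \<le> (\<integral>t\<in>{-T..T}. d / sqrt n * ?F t ^ 3 \<partial>lborel)"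
      proof (rule abs_leI)
        show "(\<integral>t\<in>{-T..T}. ?f t - ?h t \<partial>lborel) \<le> (\<integral>t\<in>{-T..T}. d / sqrt n * ?F t ^ 3 \<partial>lborel)"
          using fh by (intro set_integral_mono intF set_integral_diff intf inth) (auto simp: abs_le_iff)
        have "(\<integral>t\<in>{-T..T}. ?h t - ?f t \<partial>lborel) \<le> (\<integral>t\<in>{-T..T}. d / sqrt n * ?F t ^ 3 \<partial>lborel)"
          using fh by (intro set_integral_mono intF set_integral_diff intf inth) (auto simp: abs_le_iff)
        then show "- (\<integral>t\<in>{-T..T}. ?f t - ?h t \<partial>lborel) \<le> (\<integral>t\<in>{-T..T}. d / sqrt n * ?F t ^ 3 \<partial>lborel)"
          using set_integral_diff(2)[OF intf inth] set_integral_diff(2)[OF inth intf] by linarith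
      qed
      finally show ?thesis by (simp only: set_integral_mult_right)
    qed
    then have "(\<integral>\<^sup>+\<omega>. ennreal \<bar>real n * Delta w T X m n \<omega> - Hint n \<omega>\<bar> \<partial>M)
        \<le> (\<integral>\<^sup>+\<omega>. ennreal (d / sqrt n * (\<integral>t\<in>{-T..T}. Uenv X m n \<omega> t ^ 3 \<partial>lborel)) \<partial>M)"
      by (intro nn_integral_mono ennreal_leI)
    also have "\<dots> \<le> ennreal (d / sqrt n * C)"
      by (rule nn_integral_cmult_le[OF _ _ C(1) C(2)[OF n]])
        (use d0 in \<open>auto simp: set_lebesgue_integral_def\<close>)
    finally show ?thesis by simp
  qed
  then show ?thesis using d0 C(1) by (intro exI[of _ "d * C"]) auto
qed

text \<open>Markov's inequality for the mean error of order \<open>1 / sqrt n\<close>. Because of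
  the scaling by \<open>n\<close>, this is the remainder of order \<open>o(1 / n)\<close> in
  probability.\<close>

lemma Delta_linearization_in_prob:
  assumes "\<epsilon> > 0"
  shows "(\<lambda>n. prob {\<omega> \<in> space M. \<epsilon> < \<bar>real n * Delta w T X m n \<omega> - Hint n \<omega>\<bar>}) \<longlonglongrightarrow> 0"
proof -
  obtain C where C: "C \<ge> 0" "\<And>n. n \<ge> 1 \<Longrightarrow>
      (\<integral>\<^sup>+\<omega>. ennreal \<bar>real n * Delta w T X m n \<omega> - Hint n \<omega>\<bar> \<partial>M) \<le> ennreal (C / sqrt n)"
    using Delta_linearization_error by blast
  have lim: "(\<lambda>n. C / sqrt (real n) / \<epsilon>) \<longlonglongrightarrow> 0"
    by (intro tendsto_divide_zero tendsto_divide_0[OF tendsto_const] filterlim_at_top_imp_at_infinity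
        filterlim_compose[OF sqrt_at_top] filterlim_real_sequentially)
  show ?thesis
  proof (rule tendsto_sandwich[OF _ _ tendsto_const lim])
    show "\<forall>\<^sub>F n in sequentially. prob {\<omega> \<in> space M. \<epsilon> < \<bar>real n * Delta w T X m n \<omega> - Hint n \<omega>\<bar>} \<le> C / sqrt (real n) / \<epsilon>"
      using eventually_ge_at_top[of 1]
    proof eventually_elim
      case (elim n)
      show ?case by (rule prob_abs_gt_le) (use C(2)[OF elim] C(1) assms in auto)
    qed
  qed simp
qed

text \<open>Markov's inequality with the first moment, which is \<open>Delta_power_bound\<close> at
  exponent \<open>Suc 0\<close>.\<close>

lemma Delta_bounded_in_prob:
  assumes "\<epsilon> > 0"
  shows "\<exists>K N. \<forall>n\<ge>N. prob {\<omega> \<in> space M. K < \<bar>real n * Delta w T X m n \<omega>\<bar>} \<le> \<epsilon>"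
proof -
  obtain C where C: "C \<ge> 0" "\<And>n. n \<ge> 1 \<Longrightarrow>
      (\<integral>\<^sup>+\<omega>. ennreal (real n * Delta w T X m n \<omega>) \<partial>M) \<le> ennreal C"
    using Delta_power_bound[of 0] by auto
  \<comment> \<open>The summand 1 keeps the threshold positive when \<open>C = 0\<close>.\<close>
  have "prob {\<omega> \<in> space M. (C + 1) / \<epsilon> < \<bar>real n * Delta w T X m n \<omega>\<bar>} \<le> \<epsilon>" if "n \<ge> 1" for n
  proof -
    have "prob {\<omega> \<in> space M. (C + 1) / \<epsilon> < \<bar>real n * Delta w T X m n \<omega>\<bar>} \<le> C / ((C + 1) / \<epsilon>)"
      by (rule prob_abs_gt_le) (use C(2)[OF that] C(1) assms in \<open>auto simp: Delta_nonneg\<close>)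
    also have "\<dots> \<le> \<epsilon>" using C(1) assms by (simp add: field_simps)
    finally show ?thesis .
  qed
  then show ?thesis by blast
qed

lemma Delta_powr_SUP_finite:
  assumes "p \<ge> 1"
  shows "(SUP n\<in>{1..}. (\<integral>\<^sup>+\<omega>. ennreal ((real n * Delta w T X m n \<omega>) powr p) \<partial>M)) < \<infinity>"
proof -
  obtain C where C: "\<And>n. n \<ge> 1 \<Longrightarrow> (\<integral>\<^sup>+\<omega>. ennreal ((real n * Delta w T X m n \<omega>) powr p) \<partial>M) \<le> ennreal C"
    using Delta_powr_bound[of p] assms by auto
  have "(SUP n\<in>{1..}. (\<integral>\<^sup>+\<omega>. ennreal ((real n * Delta w T X m n \<omega>) powr p) \<partial>M)) \<le> ennreal C"
    using C by (intro SUP_least) auto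
  also have "\<dots> < \<infinity>" by simp
  finally show ?thesis .
qed

text \<open>Boundedness of moments of order \<open>2 * p\<close> suffices: where
  \<open>?Y n \<omega>\<close> exceeds \<open>K\<close> it is at most its square divided by
  \<open>K\<close>, so the tails are of order \<open>1 / K\<close> uniformly in
  \<open>n\<close>.\<close>

lemma Delta_powr_unif_integrable:
  assumes p: "p \<ge> 1"
  shows "unif_integrable M (\<lambda>n \<omega>. (real n * Delta w T X m n \<omega>) powr p) {1..}"
proof -
  let ?Y = "\<lambda>n \<omega>. (real n * Delta w T X m n \<omega>) powr p"
  obtain C where C: "\<And>n. n \<ge> 1 \<Longrightarrow> (\<integral>\<^sup>+\<omega>. ennreal (?Y n \<omega>) \<partial>M) \<le> ennreal C"
    using Delta_powr_bound[of p] p by auto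
  obtain B where B: "B \<ge> 0" "\<And>n. n \<ge> 1 \<Longrightarrow>
      (\<integral>\<^sup>+\<omega>. ennreal ((real n * Delta w T X m n \<omega>) powr (2 * p)) \<partial>M) \<le> ennreal B"
    using Delta_powr_bound[of "2 * p"] p by auto
  have int: "integrable M (?Y n)" if "n \<ge> 1" for n
    using le_less_trans[OF C[OF that] ennreal_less_top]
    by (intro integrableI_bounded) auto
  have tail: "(\<integral>\<^sup>+\<omega>. ennreal (indicator {\<omega>. K < \<bar>?Y n \<omega>\<bar>} \<omega> * \<bar>?Y n \<omega>\<bar>) \<partial>M) \<le> ennreal (1 / K * B)"
    if K: "K > 0" and n: "n \<ge> 1" for K n
  proof -
    have "(\<integral>\<^sup>+\<omega>. ennreal (indicator {\<omega>. K < \<bar>?Y n \<omega>\<bar>} \<omega> * \<bar>?Y n \<omega>\<bar>) \<partial>M)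
        \<le> (\<integral>\<^sup>+\<omega>. ennreal (1 / K * (real n * Delta w T X m n \<omega>) powr (2 * p)) \<partial>M)"
    proof (intro nn_integral_mono ennreal_leI)
      fix \<omega>
      have "(real n * Delta w T X m n \<omega>) powr (2 * p) = ?Y n \<omega> * ?Y n \<omega>"
        by (simp add: powr_add[symmetric])
      moreover have "?Y n \<omega> \<le> 1 / K * (?Y n \<omega> * ?Y n \<omega>)" if "K < ?Y n \<omega>"
      proof -
        have "K * ?Y n \<omega> \<le> ?Y n \<omega> * ?Y n \<omega>" using that by (intro mult_right_mono) auto
        then show ?thesis using K by (simp add: field_simps)
      qed
      ultimately show "indicator {\<omega>. K < \<bar>?Y n \<omega>\<bar>} \<omega> * \<bar>?Y n \<omega>\<bar> \<le> 1 / K * (real n * Delta w T X m n \<omega>) powr (2 * p)"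
        using K by (auto simp: indicator_def)
    qed
    also have "\<dots> \<le> ennreal (1 / K * B)"
      by (rule nn_integral_cmult_le[OF _ _ B(1) B(2)[OF n]]) (use K in auto)
    finally show ?thesis .
  qed
  have "((\<lambda>K. ennreal (1 / K * B)) \<longlongrightarrow> ennreal 0) at_top"
    by (intro tendsto_ennrealI tendsto_mult_left_zero tendsto_divide_0[OF tendsto_const]
        filterlim_at_top_imp_at_infinity filterlim_ident)
  then have lim: "((\<lambda>K. ennreal (1 / K * B)) \<longlongrightarrow> 0) at_top" by simp
  have "((\<lambda>K. SUP n\<in>{1..}. (\<integral>\<^sup>+\<omega>. ennreal (indicator {\<omega>. K < \<bar>?Y n \<omega>\<bar>} \<omega> * \<bar>?Y n \<omega>\<bar>) \<partial>M)) \<longlongrightarrow> 0) at_top"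
  proof (rule tendsto_sandwich[OF _ _ tendsto_const lim])
    show "\<forall>\<^sub>F K in at_top. (SUP n\<in>{1..}. (\<integral>\<^sup>+\<omega>. ennreal (indicator {\<omega>. K < \<bar>?Y n \<omega>\<bar>} \<omega> * \<bar>?Y n \<omega>\<bar>) \<partial>M)) \<le> ennreal (1 / K * B)"
      using eventually_gt_at_top[of 0]
      by eventually_elim (intro SUP_least tail, auto)
  qed simp
  then show ?thesis unfolding unif_integrable_def using int by auto
qed

end

text \<open>Both stochastic orders are stated after scaling by \<open>n\<close>. The measurability
  conjuncts guarantee that the probabilities are those of genuine events, and the supremum of
  extended integrals makes finiteness include existence of the moments.\<close>

theorem theorem1:
  fixes M :: "'a measure" and X :: "nat \<Rightarrow> 'a \<Rightarrow> real"
    and \<mu> \<sigma>2 T \<beta> :: real and Mmax m :: nat and w :: "real \<Rightarrow> real"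
  assumes "prob_space M"
    and "prob_space.indep_vars M (\<lambda>_. borel) X UNIV"
    and "\<And>i. distributed M lborel (X i) (normal_density \<mu> (sqrt \<sigma>2))"
    and "\<sigma>2 > 0" and "T > 0" and "\<beta> > 0"
    and "w = (\<lambda>t. exp (- \<beta> * t\<^sup>2))"
    and "m \<in> {1..Mmax}"
  shows
    "(\<forall>n\<ge>1. Delta w T X m n \<in> borel_measurable M) \<and>
     (\<forall>n\<ge>1. (\<lambda>\<omega>. real n * Delta w T X m n \<omega>
             - (\<integral>t\<in>{-T..T}. w t * (psi0 t)\<^sup>2 * (cmod (Hfun X m n \<omega> t))\<^sup>2 \<partial>lborel))
        \<in> borel_measurable M) \<and>
     (\<forall>\<epsilon>>0. (\<lambda>n. measure M {\<omega>\<in>space M. \<epsilon> <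
        \<bar>real n * Delta w T X m n \<omega>
          - (\<integral>t\<in>{-T..T}. w t * (psi0 t)\<^sup>2 * (cmod (Hfun X m n \<omega> t))\<^sup>2 \<partial>lborel)\<bar>})
        \<longlonglongrightarrow> 0) \<and>
     (\<forall>\<epsilon>>0. \<exists>K N. \<forall>n\<ge>N. measure M {\<omega>\<in>space M. K < \<bar>real n * Delta w T X m n \<omega>\<bar>} \<le> \<epsilon>) \<and>
     (\<forall>p::real. p \<ge> 1 \<longrightarrow>
        (SUP n\<in>{1..}. (\<integral>\<^sup>+\<omega>. ennreal ((real n * Delta w T X m n \<omega>) powr p) \<partial>M)) < \<infinity> \<and>
        unif_integrable M (\<lambda>n \<omega>. (real n * Delta w T X m n \<omega>) powr p) {1..})"
proof -
  interpret prob_space M by fact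
  interpret normal_sample M X \<mu> "sqrt \<sigma>2" T m w
  proof unfold_locales
    show "w t \<le> 1" for t using assms by simp
  qed (use assms in auto)
  have "(\<lambda>\<omega>. real n * Delta w T X m n \<omega> - Hint n \<omega>) \<in> borel_measurable M" for n
    by measurable
  \<comment> \<open>Unfolding \<open>Hint\<close> restores the explicit integral of the leading
    term.\<close>
  note * = this[unfolded Hint_def] Delta_linearization_in_prob[unfolded Hint_def]
  show ?thesis
    by (intro conjI allI impI Delta_measurable * Delta_bounded_in_prob Delta_powr_SUP_finite
        Delta_powr_unif_integrable)
qed

end
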